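(* Let $k\ge3$ be an integer. Then $\mathrm{DF}(\beta)$ is a polytope with rational vertices for Lebesgue almost every $\beta\in(k-1,k)$.
   Context: $\mathbb{N}$ includes $0$. $\Delta=\{\boldsymbol\alpha\in\mathbb{R}^k_{\ge0} : \sum_{i=0}^{k-1}\alpha_i=1\}$. For $\beta\in(k-1,k)$ let $f_\beta\colon[0,1]\to[0,1]$, $f_\beta(x)=\beta x\bmod 1$. The digit sequence of the greedy $\beta$-expansion of $x\in[0,1]$ is $d_\beta(x)\in\{0,1,\ldots,k-1\}^{\mathbb{N}}$, $d_\beta(x)_r=\lfloor\beta f_\beta^r(x)\rfloor$ for $r\ge 0$. The number $x$ has $\beta$-digit frequency $\boldsymbol\alpha\in\Delta$ if, for each $0\le i\le k-1$, $N_{i,r}/r\to\alpha_i$ as $r\to\infty$, where $N_{i,r}$ is the number of digits equal to $i$ among the first $r$ entries of $d_\beta(x)$. $\mathrm{DF}(\beta)\subset\Delta$ is the set of all $\beta$-digit frequencies of those $x\in[0,1]$ which have a well-defined $\beta$-digit frequency. A point of $\Delta$ is rational if it lies in $\mathbb{Q}^k$. *)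

theory Defs
  imports "HOL-Analysis.Analysis"
begin

text \<open>
  Vectors in \<open>R^k\<close> are rendered as \<open>real ^ 'k\<close> for a finite type \<open>'k\<close> with \<open>k\<close> elements.
  Since \<open>'k\<close> carries no canonical numbering, a labelling \<open>lab\<close> (used only when it is a
  bijection from \<open>'k\<close> onto \<open>{0, ..., k - 1}\<close>) says which digit each coordinate stands for.
\<close>

definition freq_simplex :: "(real ^ 'k) set" where
  "freq_simplex = {\<alpha>. (\<forall>i. 0 \<le> \<alpha> $ i) \<and> (\<Sum>i\<in>UNIV. \<alpha> $ i) = 1}"

definition beta_map :: "real \<Rightarrow> real \<Rightarrow> real" where
  "beta_map \<beta> x = frac (\<beta> * x)"

definition beta_digit :: "real \<Rightarrow> real \<Rightarrow> nat \<Rightarrow> nat" where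
  "beta_digit \<beta> x r = nat \<lfloor>\<beta> * (beta_map \<beta> ^^ r) x\<rfloor>"

definition digit_count :: "real \<Rightarrow> real \<Rightarrow> nat \<Rightarrow> nat \<Rightarrow> nat" where
  "digit_count \<beta> x d r = card {s. s < r \<and> beta_digit \<beta> x s = d}"

definition has_digit_frequency :: "('k \<Rightarrow> nat) \<Rightarrow> real \<Rightarrow> real \<Rightarrow> real ^ 'k \<Rightarrow> bool" where
  "has_digit_frequency lab \<beta> x \<alpha> \<longleftrightarrow>
     (\<forall>i. (\<lambda>r. real (digit_count \<beta> x (lab i) r) / real r) \<longlonglongrightarrow> \<alpha> $ i)"

definition DF :: "('k \<Rightarrow> nat) \<Rightarrow> real \<Rightarrow> (real ^ 'k) set" where
  "DF lab \<beta> = {\<alpha> \<in> freq_simplex. \<exists>x\<in>{0..1}. has_digit_frequency lab \<beta> x \<alpha>}"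

definition rational_point :: "real ^ 'k \<Rightarrow> bool" where
  "rational_point \<alpha> \<longleftrightarrow> (\<forall>i. \<alpha> $ i \<in> \<rat>)"

end

theory Submission
  imports Defs
begin

text \<open>
  Let \<open>w\<close> be the expansion of 1. Expansions of numbers below 1 are concatenations of blocks, a block
  being a proper prefix of \<open>w\<close> followed by a digit smaller than the next digit of \<open>w\<close>. If the count
  vector of some prefix of \<open>w\<close> of length \<open>n\<close> lies in the cone of the count vectors of the blocks of length
  at most \<open>n\<close>, then that prefix can replace the beginning of every longer block, so \<open>DF\<close> is the convex
  hull of the finitely many rational frequency vectors of the short blocks. Let \<open>j > 0\<close> be the
  position of the first nonzero digit after \<open>w\<^sub>0\<close>. The cone condition holds as soon as some
  concatenation of blocks \<open>w\<^sub>1 \<dots> w\<^sub>p\<^sub>-\<^sub>1\<close> is followed by \<open>j\<close> zeros, since \<open>w\<^sub>0 0\<^sup>j\<close> is a block.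

  Such \<open>p\<close> without the condition on zeros are unbounded. On the interval of parameters with a given
  prefix of length \<open>p\<close>, the \<open>p\<close>-th point of the orbit of 1 is a convex function starting from 0, hence
  it is followed by \<open>j\<close> zeros on a proportion at least \<open>1/k\<^sup>j\<close> of the interval, at all scales. So
  the exceptional parameters form a null set.
\<close>

subsection \<open>Orbits and digits\<close>

definition orb :: "real \<Rightarrow> real \<Rightarrow> nat \<Rightarrow> real" where
  "orb \<beta> x r = (beta_map \<beta> ^^ r) x"

lemma orb_0 [simp]: "orb \<beta> x 0 = x"
  by (simp add: orb_def)

lemma orb_Suc: "orb \<beta> x (Suc r) = frac (\<beta> * orb \<beta> x r)"
  by (simp add: orb_def beta_map_def)

lemma orb_add: "orb \<beta> (orb \<beta> x p) r = orb \<beta> x (p + r)"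
  by (simp add: orb_def funpow_add add.commute[of p r])

lemma beta_digit_orb: "beta_digit \<beta> x r = nat \<lfloor>\<beta> * orb \<beta> x r\<rfloor>"
  by (simp add: beta_digit_def orb_def)

lemma beta_digit_shift: "beta_digit \<beta> (orb \<beta> x p) r = beta_digit \<beta> x (p + r)"
  by (simp add: beta_digit_orb orb_add)

lemma orb_Suc_less_1: "orb \<beta> x (Suc r) < 1" and orb_Suc_nonneg: "0 \<le> orb \<beta> x (Suc r)"
  by (simp_all add: orb_Suc frac_lt_1)

lemma orb_nonneg: "0 \<le> x \<Longrightarrow> 0 \<le> orb \<beta> x r"
  by (cases r) (simp_all add: orb_Suc_nonneg)

lemma orb_le_1: "x \<le> 1 \<Longrightarrow> orb \<beta> x r \<le> 1"
  using orb_Suc_less_1 by (cases r) (auto intro: less_imp_le)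

lemma orb_less_1: "x < 1 \<Longrightarrow> orb \<beta> x r < 1"
  using orb_Suc_less_1 by (cases r) auto

lemma digit_plus_orb:
  assumes "0 \<le> \<beta>" "0 \<le> x"
  shows "\<beta> * orb \<beta> x r = real (beta_digit \<beta> x r) + orb \<beta> x (Suc r)"
proof -
  have "0 \<le> \<lfloor>\<beta> * orb \<beta> x r\<rfloor>"
    using assms orb_nonneg by simp
  then show ?thesis
    by (simp add: beta_digit_orb orb_Suc frac_def)
qed

lemma beta_digit_less:
  assumes "0 \<le> \<beta>" "\<beta> < real k" "0 \<le> x" "x \<le> 1"
  shows "beta_digit \<beta> x r < k"
proof -
  have "\<beta> * orb \<beta> x r \<le> \<beta>"
    using assms orb_le_1[of x \<beta> r] by (simp add: mult_left_le)
  moreover have "0 \<le> \<beta> * orb \<beta> x r"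
    using assms orb_nonneg by simp
  ultimately show ?thesis
    using assms unfolding beta_digit_orb by linarith
qed

lemma beta_digit_eqI:
  assumes "\<beta> * orb \<beta> x r = real d + z" "0 \<le> z" "z < 1"
  shows "beta_digit \<beta> x r = d" "orb \<beta> x (Suc r) = z"
proof -
  have *: "\<lfloor>\<beta> * orb \<beta> x r\<rfloor> = int d"
    using assms by (intro floor_unique) auto
  show "beta_digit \<beta> x r = d" "orb \<beta> x (Suc r) = z"
    using * assms(1) by (simp_all add: beta_digit_orb orb_Suc frac_def)
qed

lemma orb_diff:
  assumes "0 \<le> \<beta>" "0 \<le> x" "0 \<le> y" "\<And>i. i < n \<Longrightarrow> beta_digit \<beta> x i = beta_digit \<beta> y i"
  shows "orb \<beta> x n - orb \<beta> y n = \<beta> ^ n * (x - y)"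
  using assms(4)
proof (induction n)
  case (Suc n)
  have "orb \<beta> x (Suc n) - orb \<beta> y (Suc n) = \<beta> * (orb \<beta> x n - orb \<beta> y n)"
    using digit_plus_orb[of \<beta> x n] digit_plus_orb[of \<beta> y n] assms(1-3) Suc.prems[of n]
    by (simp add: right_diff_distrib)
  then show ?case
    using Suc by simp
qed simp

text \<open>While the digits agree, the gap between the orbits is multiplied by
  \<open>\<beta>\<close> at each step, which cannot go on inside the unit interval. At the first
  mismatch the orbits are still in order, and floors preserve order.\<close>

lemma first_mismatch:
  assumes "1 < \<beta>" "0 \<le> y" "y < x" "x \<le> 1"
  obtains s where "\<And>i. i < s \<Longrightarrow> beta_digit \<beta> y i = beta_digit \<beta> x i"
    "beta_digit \<beta> y s < beta_digit \<beta> x s"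
proof -
  have "\<exists>i. beta_digit \<beta> y i \<noteq> beta_digit \<beta> x i"
  proof (rule ccontr)
    assume "\<not> ?thesis"
    then have *: "orb \<beta> x n - orb \<beta> y n = \<beta> ^ n * (x - y)" for n
      using assms by (intro orb_diff) auto
    obtain n where "1 / (x - y) < \<beta> ^ n"
      using real_arch_pow[OF assms(1)] by blast
    then have "1 < orb \<beta> x n - orb \<beta> y n"
      using assms by (simp add: * field_simps)
    moreover have "orb \<beta> x n \<le> 1" "0 \<le> orb \<beta> y n"
      using assms by (auto intro: orb_le_1 orb_nonneg)
    ultimately show False by simp
  qed
  then obtain s where s: "beta_digit \<beta> y s \<noteq> beta_digit \<beta> x s"
    "\<And>i. i < s \<Longrightarrow> beta_digit \<beta> y i = beta_digit \<beta> x i"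
    using exists_least_iff[of "\<lambda>i. beta_digit \<beta> y i \<noteq> beta_digit \<beta> x i"] by auto
  have "orb \<beta> x s - orb \<beta> y s = \<beta> ^ s * (x - y)"
    using assms s(2) by (intro orb_diff) auto
  moreover have "0 \<le> \<beta> ^ s * (x - y)"
    using assms by simp
  ultimately have "orb \<beta> y s \<le> orb \<beta> x s"
    by simp
  then have "beta_digit \<beta> y s \<le> beta_digit \<beta> x s"
    using assms unfolding beta_digit_orb
    by (intro nat_mono floor_mono mult_left_mono) auto
  with s that show ?thesis
    using le_neq_implies_less by blast
qed

subsection \<open>Count vectors and blocks\<close>

definition digit_unit :: "('k \<Rightarrow> nat) \<Rightarrow> nat \<Rightarrow> real ^ 'k" where
  "digit_unit lab d = (\<chi> i. if lab i = d then 1 else 0)"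

definition count_vec :: "('k \<Rightarrow> nat) \<Rightarrow> real \<Rightarrow> real \<Rightarrow> nat \<Rightarrow> real ^ 'k" where
  "count_vec lab \<beta> x r = (\<Sum>s<r. digit_unit lab (beta_digit \<beta> x s))"

lemma count_vec_0 [simp]: "count_vec lab \<beta> x 0 = 0"
  by (simp add: count_vec_def)

lemma count_vec_Suc: "count_vec lab \<beta> x (Suc r) = count_vec lab \<beta> x r + digit_unit lab (beta_digit \<beta> x r)"
  by (simp add: count_vec_def)

lemma count_vec_add: "count_vec lab \<beta> x (p + r) = count_vec lab \<beta> x p + count_vec lab \<beta> (orb \<beta> x p) r"
  by (induction r) (simp_all add: count_vec_Suc beta_digit_shift)

lemma count_vec_cong:
  "(\<And>i. i < r \<Longrightarrow> beta_digit \<beta> x i = beta_digit \<beta> y i) \<Longrightarrow> count_vec lab \<beta> x r = count_vec lab \<beta> y r"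
  by (simp add: count_vec_def)

lemma count_vec_nth: "count_vec lab \<beta> x r $ i = real (digit_count \<beta> x (lab i) r)"
proof -
  have "count_vec lab \<beta> x r $ i = (\<Sum>s<r. if lab i = beta_digit \<beta> x s then 1 else 0)"
    by (simp add: count_vec_def digit_unit_def)
  also have "\<dots> = real (card {s. s < r \<and> beta_digit \<beta> x s = lab i})"
    by (subst sum.If_cases) (auto intro!: arg_cong[of _ _ card])
  finally show ?thesis by (simp add: digit_count_def)
qed

lemma has_digit_frequency_count_vec:
  "has_digit_frequency lab \<beta> x \<alpha> \<longleftrightarrow> (\<lambda>r. count_vec lab \<beta> x r /\<^sub>R real r) \<longlonglongrightarrow> \<alpha>"
  unfolding has_digit_frequency_def
proof safe
  assume "\<forall>i. (\<lambda>r. real (digit_count \<beta> x (lab i) r) / real r) \<longlonglongrightarrow> \<alpha> $ i"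
  then show "(\<lambda>r. count_vec lab \<beta> x r /\<^sub>R real r) \<longlonglongrightarrow> \<alpha>"
    by (intro vec_tendstoI) (simp add: count_vec_nth divide_inverse mult.commute)
next
  fix i
  assume "(\<lambda>r. count_vec lab \<beta> x r /\<^sub>R real r) \<longlonglongrightarrow> \<alpha>"
  from tendsto_vec_nth[OF this, of i]
  show "(\<lambda>r. real (digit_count \<beta> x (lab i) r) / real r) \<longlonglongrightarrow> \<alpha> $ i"
    by (simp add: count_vec_nth divide_inverse mult.commute)
qed

section \<open>Coordinate sums and norms of count vectors\<close>

definition coord_sum :: "real ^ 'k \<Rightarrow> real" where
  "coord_sum v = (\<Sum>i\<in>UNIV. v $ i)"

lemma coord_sum_simps [simp]:
  "coord_sum (u + v) = coord_sum u + coord_sum v" "coord_sum (c *\<^sub>R v) = c * coord_sum v" "coord_sum 0 = 0"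
  by (simp_all add: coord_sum_def sum.distrib sum_distrib_left)

lemma digit_unit_nonneg: "0 \<le> digit_unit lab d $ i"
  by (simp add: digit_unit_def)

lemma coord_sum_digit_unit:
  fixes lab :: "'k::finite \<Rightarrow> nat"
  assumes "bij_betw lab UNIV {..<k}" "d < k"
  shows "coord_sum (digit_unit lab d) = 1"
proof -
  obtain i where i: "lab i = d"
    using assms by (metis bij_betw_imp_surj_on imageE lessThan_iff)
  have "(\<lambda>j. if lab j = d then 1 else 0) = (\<lambda>j. if j = i then 1 else 0 :: real)"
    using assms(1) i by (auto simp: bij_betw_def inj_def)
  then show ?thesis
    by (simp add: coord_sum_def digit_unit_def)
qed

lemma norm_digit_unit:
  fixes lab :: "'k::finite \<Rightarrow> nat"
  assumes "bij_betw lab UNIV {..<k}" "d < k"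
  shows "norm (digit_unit lab d) \<le> 1"
proof -
  have "norm (digit_unit lab d) \<le> (\<Sum>i\<in>UNIV. \<bar>digit_unit lab d $ i\<bar>)"
    by (rule norm_le_l1_cart)
  also have "\<dots> = coord_sum (digit_unit lab d)"
    by (simp add: coord_sum_def digit_unit_nonneg)
  finally show ?thesis
    using coord_sum_digit_unit[OF assms] by simp
qed

lemma coord_sum_count_vec:
  fixes lab :: "'k::finite \<Rightarrow> nat"
  assumes "bij_betw lab UNIV {..<k}" "0 \<le> \<beta>" "\<beta> < real k" "0 \<le> x" "x \<le> 1"
  shows "coord_sum (count_vec lab \<beta> x r) = real r"
  by (induction r) (simp_all add: count_vec_Suc coord_sum_digit_unit[OF assms(1)] beta_digit_less assms)

lemma norm_count_vec:
  fixes lab :: "'k::finite \<Rightarrow> nat"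
  assumes "bij_betw lab UNIV {..<k}" "0 \<le> \<beta>" "\<beta> < real k" "0 \<le> x" "x \<le> 1"
  shows "norm (count_vec lab \<beta> x r) \<le> real r"
proof (induction r)
  case (Suc r)
  have "norm (digit_unit lab (beta_digit \<beta> x r)) \<le> 1"
    using assms by (intro norm_digit_unit[OF assms(1)] beta_digit_less) auto
  with Suc show ?case
    unfolding count_vec_Suc using norm_triangle_mono by fastforce
qed simp

text \<open>The block indexed by \<open>(s, d)\<close> is the word \<open>w\<^sub>0 \<dots> w\<^sub>s\<^sub>-\<^sub>1 d\<close> with \<open>d < w\<^sub>s\<close>, where \<open>w\<close> is the
  expansion of 1.\<close>

definition block_vec :: "('k \<Rightarrow> nat) \<Rightarrow> real \<Rightarrow> nat \<times> nat \<Rightarrow> real ^ 'k" where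
  "block_vec lab \<beta> b = count_vec lab \<beta> 1 (fst b) + digit_unit lab (snd b)"

definition blocks :: "real \<Rightarrow> nat \<Rightarrow> (nat \<times> nat) set" where
  "blocks \<beta> n = {b. fst b < n \<and> snd b < beta_digit \<beta> 1 (fst b)}"

definition block_freqs :: "('k \<Rightarrow> nat) \<Rightarrow> real \<Rightarrow> nat \<Rightarrow> (real ^ 'k) set" where
  "block_freqs lab \<beta> n = (\<lambda>b. block_vec lab \<beta> b /\<^sub>R real (Suc (fst b))) ` blocks \<beta> n"

text \<open>Keeping the factor \<open>L\<close> apart from the hull point allows \<open>L\<close> to
  be recovered later: points of the hull have coordinate sum 1, so \<open>L\<close> counts
  digits.\<close>

definition block_cone :: "('k \<Rightarrow> nat) \<Rightarrow> real \<Rightarrow> nat \<Rightarrow> (real ^ 'k) set" where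
  "block_cone lab \<beta> n = {L *\<^sub>R q | L q. 0 \<le> L \<and> q \<in> convex hull (block_freqs lab \<beta> n)}"

lemma finite_blocks: "finite (blocks \<beta> n)"
proof -
  have "blocks \<beta> n \<subseteq> (SIGMA s:{..<n}. {..<beta_digit \<beta> 1 s})"
    by (auto simp: blocks_def)
  then show ?thesis
    by (rule finite_subset) auto
qed

lemma finite_block_freqs: "finite (block_freqs lab \<beta> n)"
  by (simp add: block_freqs_def finite_blocks)

lemma block_freqs_nonempty:
  assumes "1 \<le> \<beta>" "0 < n"
  shows "block_freqs lab \<beta> n \<noteq> {}"
proof -
  \<comment> \<open>The one-letter word 0 is a block, because the leading digit of 1 is at least
    1.\<close>
  have "(0, 0) \<in> blocks \<beta> n"
    using assms by (simp add: blocks_def beta_digit_orb)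
  then show ?thesis by (auto simp: block_freqs_def)
qed

lemma block_cone_mono: "m \<le> n \<Longrightarrow> block_cone lab \<beta> m \<subseteq> block_cone lab \<beta> n"
proof -
  assume "m \<le> n"
  then have "block_freqs lab \<beta> m \<subseteq> block_freqs lab \<beta> n"
    by (auto simp: block_freqs_def blocks_def)
  then have "convex hull (block_freqs lab \<beta> m) \<subseteq> convex hull (block_freqs lab \<beta> n)"
    by (rule hull_mono)
  then show ?thesis by (auto simp: block_cone_def)
qed

lemma zero_in_block_cone:
  assumes "1 \<le> \<beta>" "0 < n"
  shows "0 \<in> block_cone lab \<beta> n"
  using block_freqs_nonempty[OF assms, of lab] hull_subset[of "block_freqs lab \<beta> n" convex]
  unfolding block_cone_def by force

lemma block_cone_add:
  assumes "u \<in> block_cone lab \<beta> n" "v \<in> block_cone lab \<beta> n"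
  shows "u + v \<in> block_cone lab \<beta> n"
proof -
  let ?S = "convex hull (block_freqs lab \<beta> n)"
  obtain L q where u: "u = L *\<^sub>R q" "0 \<le> L" "q \<in> ?S"
    using assms(1) by (auto simp: block_cone_def)
  obtain M p where v: "v = M *\<^sub>R p" "0 \<le> M" "p \<in> ?S"
    using assms(2) by (auto simp: block_cone_def)
  show ?thesis
  proof (cases "L + M = 0")
    case True
    then have "u + v = 0 *\<^sub>R q"
      using u v by (simp add: add_nonneg_eq_0_iff)
    then show ?thesis
      unfolding block_cone_def using u(3) by blast
  next
    case False
    define z where "z = (L / (L + M)) *\<^sub>R q + (M / (L + M)) *\<^sub>R p"
    have "z \<in> ?S"
      unfolding z_def using u v False
      by (intro convexD[OF convex_convex_hull]) (auto simp: add_divide_distrib[symmetric])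
    moreover have "u + v = (L + M) *\<^sub>R z"
      using False by (simp add: z_def u v scaleR_add_right)
    ultimately show ?thesis
      unfolding block_cone_def using u v by (blast intro: add_nonneg_nonneg)
  qed
qed

lemma block_vec_in_cone:
  assumes "b \<in> blocks \<beta> n"
  shows "block_vec lab \<beta> b \<in> block_cone lab \<beta> n"
proof -
  have "block_vec lab \<beta> b /\<^sub>R real (Suc (fst b)) \<in> convex hull (block_freqs lab \<beta> n)"
    using assms by (intro hull_inc) (auto simp: block_freqs_def)
  moreover have "block_vec lab \<beta> b = real (Suc (fst b)) *\<^sub>R (block_vec lab \<beta> b /\<^sub>R real (Suc (fst b)))"
    by simp
  ultimately show ?thesis
    unfolding block_cone_def by (blast intro: of_nat_0_le_iff)
qed

lemma rational_block_freqs: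
  assumes "v \<in> block_freqs lab \<beta> n"
  shows "rational_point v"
  using assms
  by (auto simp: block_freqs_def rational_point_def block_vec_def count_vec_nth digit_unit_def
      intro!: Rats_mult Rats_inverse Rats_add simp del: of_nat_Suc)

lemma block_freqs_subset_simplex:
  fixes lab :: "'k::finite \<Rightarrow> nat"
  assumes "bij_betw lab UNIV {..<k}" "0 \<le> \<beta>" "\<beta> < real k"
  shows "convex hull (block_freqs lab \<beta> n) \<subseteq> freq_simplex"
proof (rule hull_minimal)
  show "block_freqs lab \<beta> n \<subseteq> freq_simplex"
  proof
    fix v assume "v \<in> block_freqs lab \<beta> n"
    then obtain s d where b: "v = block_vec lab \<beta> (s, d) /\<^sub>R real (Suc s)" "d < beta_digit \<beta> 1 s"
      by (auto simp: block_freqs_def blocks_def)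
    have "d < k"
      using b(2) beta_digit_less[of \<beta> k 1 s] assms by simp
    then have "coord_sum (block_vec lab \<beta> (s, d)) = real (Suc s)"
      using assms by (simp add: block_vec_def coord_sum_count_vec coord_sum_digit_unit)
    then have "coord_sum v = 1"
      by (simp add: b(1) del: of_nat_Suc)
    moreover have "0 \<le> v $ i" for i
      by (simp add: b(1) block_vec_def count_vec_nth digit_unit_nonneg)
    ultimately show "v \<in> freq_simplex"
      by (simp add: freq_simplex_def coord_sum_def)
  qed
  show "convex (freq_simplex :: (real ^ 'k) set)"
    by (auto simp: convex_def freq_simplex_def sum.distrib sum_distrib_left[symmetric])
qed

subsection \<open>Frequencies lie in the hull of the short blocks\<close>

text \<open>Parsing from the left. Let \<open>t\<close> be the first position where \<open>y\<close>
  falls below the expansion of 1. If \<open>t < n\<close>, a short block is split off; otherwise the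
  prefix of length \<open>n\<close> is, its count vector being in the cone by assumption. What
  remains in the end is a prefix of length \<open>s < n\<close>.\<close>

lemma count_vec_parse:
  assumes "1 < \<beta>" "0 < n" "count_vec lab \<beta> 1 n \<in> block_cone lab \<beta> n" "0 \<le> y" "y < 1"
  shows "\<exists>c\<in>block_cone lab \<beta> n. \<exists>s<n. count_vec lab \<beta> y r = c + count_vec lab \<beta> 1 s"
  using assms(4,5)
proof (induction r arbitrary: y rule: less_induct)
  case (less r)
  let ?C = "block_cone lab \<beta> n"
  obtain t where t: "\<And>i. i < t \<Longrightarrow> beta_digit \<beta> y i = beta_digit \<beta> 1 i"
    "beta_digit \<beta> y t < beta_digit \<beta> 1 t"
    using first_mismatch[OF assms(1) less.prems order_refl] by blast
  \<comment> \<open>Splitting off \<open>m\<close> digits leaves an orbit point that is again in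
    \<open>[0, 1)\<close>, so the induction hypothesis applies to it.\<close>
  have rec: ?case if m: "m \<le> r" "0 < m" "count_vec lab \<beta> y m \<in> ?C" for m
  proof -
    have "0 \<le> orb \<beta> y m" "orb \<beta> y m < 1"
      using less.prems by (auto intro: orb_nonneg orb_less_1)
    then obtain c s where c: "c \<in> ?C" "s < n"
      "count_vec lab \<beta> (orb \<beta> y m) (r - m) = c + count_vec lab \<beta> 1 s"
      using less.IH[of "r - m" "orb \<beta> y m"] m by auto
    then have "count_vec lab \<beta> y r = (count_vec lab \<beta> y m + c) + count_vec lab \<beta> 1 s"
      using count_vec_add[of lab \<beta> y m "r - m"] m by simp
    then show ?case
      using block_cone_add[OF m(3) c(1)] c(2) by blast
  qed
  show ?case
  proof (cases "r \<le> t")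
    case True
    then have eq: "count_vec lab \<beta> y r = count_vec lab \<beta> 1 r"
      using t by (intro count_vec_cong) auto
    show ?thesis
    proof (cases "r < n")
      case True
      with eq show ?thesis
        using zero_in_block_cone[of \<beta> n lab] assms by (intro bexI[of _ 0]) auto
    next
      case False
      then have "count_vec lab \<beta> y n = count_vec lab \<beta> 1 n"
        using t \<open>r \<le> t\<close> by (intro count_vec_cong) auto
      then show ?thesis
        using False assms by (intro rec[of n]) auto
    qed
  next
    case False
    show ?thesis
    proof (cases "t < n")
      case True
      have "count_vec lab \<beta> y t = count_vec lab \<beta> 1 t"
        using t by (intro count_vec_cong) auto
      then have "count_vec lab \<beta> y (Suc t) = block_vec lab \<beta> (t, beta_digit \<beta> y t)"
        by (simp add: count_vec_Suc block_vec_def)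
      moreover have "(t, beta_digit \<beta> y t) \<in> blocks \<beta> n"
        using True t by (simp add: blocks_def)
      ultimately show ?thesis
        using False by (intro rec[of "Suc t"]) (auto intro: block_vec_in_cone)
    next
      case ge: False
      then have "count_vec lab \<beta> y n = count_vec lab \<beta> 1 n"
        using t by (intro count_vec_cong) auto
      then show ?thesis
        using False ge assms by (intro rec[of n]) auto
    qed
  qed
qed

text \<open>By parsing, the count vector of \<open>r\<close> digits stays within bounded distance of
  \<open>r\<close> times a point of the hull. Dividing by \<open>r\<close> puts the limit into the
  hull, which is closed.\<close>

lemma frequency_in_hull:
  fixes lab :: "'k::finite \<Rightarrow> nat"
  assumes lab: "bij_betw lab UNIV {..<k}" and \<beta>: "1 < \<beta>" "\<beta> < real k"
    and n: "0 < n" "count_vec lab \<beta> 1 n \<in> block_cone lab \<beta> n"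
    and x: "0 \<le> x" "x \<le> 1" and freq: "has_digit_frequency lab \<beta> x \<alpha>"
  shows "\<alpha> \<in> convex hull (block_freqs lab \<beta> n)"
proof -
  let ?S = "convex hull (block_freqs lab \<beta> n)"
  have "compact ?S"
    by (intro finite_imp_compact_convex_hull finite_block_freqs)
  then obtain K where K: "\<And>q. q \<in> ?S \<Longrightarrow> norm q \<le> K"
    using compact_imp_bounded bounded_iff by metis
  have "0 \<le> K"
    using K block_freqs_nonempty[of \<beta> n lab] \<beta> n norm_ge_zero order_trans
    by (metis convex_hull_eq_empty ex_in_conv less_imp_le)
  have "\<exists>q\<in>?S. norm (count_vec lab \<beta> x (Suc r) - real (Suc r) *\<^sub>R q) \<le> real n * (1 + K)" for r
  proof -
    \<comment> \<open>Parsing needs a start below 1, while \<open>x\<close> may equal 1; hence the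
      first digit is treated separately, as \<open>e\<close>.\<close>
    define y where "y = orb \<beta> x 1"
    have y: "0 \<le> y" "y < 1"
      using orb_Suc_less_1[of \<beta> x 0] orb_Suc_nonneg[of \<beta> x 0] by (auto simp: y_def)
    obtain c s where c: "c \<in> block_cone lab \<beta> n" "s < n"
      "count_vec lab \<beta> y r = c + count_vec lab \<beta> 1 s"
      using count_vec_parse[OF \<beta>(1) n y] by blast
    obtain L q where q: "c = L *\<^sub>R q" "q \<in> ?S"
      using c(1) by (auto simp: block_cone_def)
    \<comment> \<open>Comparing coordinate sums determines the scaling: the cone part accounts for
      all but \<open>s\<close> of the \<open>r\<close> digits.\<close>
    have "coord_sum q = 1"
      using q(2) block_freqs_subset_simplex[OF lab, of \<beta> n] \<beta>
      by (auto simp: freq_simplex_def coord_sum_def)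
    moreover have "coord_sum (count_vec lab \<beta> y r) = real r" "coord_sum (count_vec lab \<beta> 1 s) = real s"
      using coord_sum_count_vec[OF lab] \<beta> y by auto
    ultimately have L: "L = real r - real s"
      using c(3) by (simp add: q(1))
    define e where "e = digit_unit lab (beta_digit \<beta> x 0)"
    have "norm e \<le> 1"
      unfolding e_def using \<beta> x by (intro norm_digit_unit[OF lab] beta_digit_less) auto
    moreover have "norm (count_vec lab \<beta> 1 s) \<le> real s"
      using \<beta> by (intro norm_count_vec[OF lab]) auto
    moreover have "norm (real (Suc s) *\<^sub>R q) \<le> real n * K"
      unfolding norm_scaleR using K[OF q(2)] c(2) by (intro mult_mono) auto
    moreover have "count_vec lab \<beta> x (Suc r) = e + count_vec lab \<beta> y r"
      using count_vec_add[of lab \<beta> x 1 r] by (simp add: e_def y_def count_vec_Suc)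
    then have "count_vec lab \<beta> x (Suc r) - real (Suc r) *\<^sub>R q
        = e + count_vec lab \<beta> 1 s - real (Suc s) *\<^sub>R q"
      by (simp add: c(3) q(1) L algebra_simps)
    moreover have "norm (e + count_vec lab \<beta> 1 s - real (Suc s) *\<^sub>R q)
        \<le> norm e + norm (count_vec lab \<beta> 1 s) + norm (real (Suc s) *\<^sub>R q)"
      by (meson norm_triangle_ineq norm_triangle_ineq4 add_right_mono order_trans)
    moreover have "real s + 1 \<le> real n"
      using c(2) by simp
    ultimately have "norm (count_vec lab \<beta> x (Suc r) - real (Suc r) *\<^sub>R q) \<le> real n * (1 + K)"
      unfolding distrib_left by simp
    then show ?thesis
      using q(2) by blast
  qed
  then obtain q where q: "\<And>r. q r \<in> ?S"
    "\<And>r. norm (count_vec lab \<beta> x (Suc r) - real (Suc r) *\<^sub>R q r) \<le> real n * (1 + K)"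
    by metis
  have lim: "(\<lambda>r. count_vec lab \<beta> x (Suc r) /\<^sub>R real (Suc r)) \<longlonglongrightarrow> \<alpha>"
    using freq unfolding has_digit_frequency_count_vec by (rule LIMSEQ_Suc)
  have "(\<lambda>r. count_vec lab \<beta> x (Suc r) /\<^sub>R real (Suc r) - q r) \<longlonglongrightarrow> 0"
  proof (rule tendsto_norm_zero_cancel, rule tendsto_sandwich[OF _ _ tendsto_const])
    show "\<forall>\<^sub>F r in sequentially. norm (count_vec lab \<beta> x (Suc r) /\<^sub>R real (Suc r) - q r)
        \<le> real n * (1 + K) * inverse (real (Suc r))"
    proof (intro always_eventually allI)
      fix r
      have "count_vec lab \<beta> x (Suc r) /\<^sub>R real (Suc r) - q r
          = (count_vec lab \<beta> x (Suc r) - real (Suc r) *\<^sub>R q r) /\<^sub>R real (Suc r)"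
        by (simp add: scaleR_diff_right del: of_nat_Suc)
      then have "norm (count_vec lab \<beta> x (Suc r) /\<^sub>R real (Suc r) - q r)
          = norm (count_vec lab \<beta> x (Suc r) - real (Suc r) *\<^sub>R q r) * inverse (real (Suc r))"
        by (simp del: of_nat_Suc)
      also have "\<dots> \<le> real n * (1 + K) * inverse (real (Suc r))"
        by (intro mult_right_mono q) simp
      finally show "norm (count_vec lab \<beta> x (Suc r) /\<^sub>R real (Suc r) - q r)
        \<le> real n * (1 + K) * inverse (real (Suc r))" .
    qed
    show "(\<lambda>r. real n * (1 + K) * inverse (real (Suc r))) \<longlonglongrightarrow> 0"
      using tendsto_mult_left[OF LIMSEQ_inverse_real_of_nat, of "real n * (1 + K)"] by simp
  qed simp
  from tendsto_diff[OF lim this] have "q \<longlonglongrightarrow> \<alpha>"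
    by simp
  moreover have "closed ?S"
    using \<open>compact ?S\<close> by (rule compact_imp_closed)
  ultimately show ?thesis
    using q(1) closed_sequentially by blast
qed

subsection \<open>Constructing numbers with prescribed frequencies\<close>

text \<open>\<open>pos r\<close> is the position of the \<open>r\<close>-th digit inside the block it belongs to.\<close>

lemma realize_block_sequence:
  fixes \<delta> pos :: "nat \<Rightarrow> nat"
  assumes \<beta>: "1 < \<beta>" and nonzero: "\<And>r. orb \<beta> 1 r \<noteq> 0"
    and "pos 0 = 0" and bounded: "\<And>r. pos r < n"
    and step: "\<And>r. \<delta> r = beta_digit \<beta> 1 (pos r) \<and> pos (Suc r) = Suc (pos r) \<or>
      \<delta> r < beta_digit \<beta> 1 (pos r) \<and> pos (Suc r) = 0"
  obtains x where "0 \<le> x" "x < 1" "\<And>r. beta_digit \<beta> x r = \<delta> r"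
proof -
  obtain k where k: "\<beta> < real k"
    using reals_Archimedean2 by blast
  have \<delta>_le: "real (\<delta> r) \<le> real k" for r
    using step[of r] beta_digit_less[of \<beta> k 1 "pos r"] \<beta> k by auto
  have summ: "summable (\<lambda>m. real (\<delta> (r + m)) / \<beta> ^ Suc m)" for r
  proof (rule summable_comparison_test'[of "\<lambda>m. real k * (1 / \<beta>) ^ m" 0])
    show "summable (\<lambda>m. real k * (1 / \<beta>) ^ m)"
      using \<beta> by (intro summable_mult summable_geometric) simp
    fix m
    have "real (\<delta> (r + m)) / \<beta> ^ Suc m \<le> real k / \<beta> ^ m"
      using \<beta> \<delta>_le[of "r + m"] by (intro frac_le) auto
    moreover have "real k * (1 / \<beta>) ^ m = real k / \<beta> ^ m"
      by (simp add: power_one_over)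
    ultimately show "norm (real (\<delta> (r + m)) / \<beta> ^ Suc m) \<le> real k * (1 / \<beta>) ^ m"
      using \<beta> by simp
  qed
  \<comment> \<open>\<open>y r\<close> is the value in base \<open>\<beta>\<close> of the digits
    from \<open>r\<close> on, and \<open>u r\<close> is the orbit point of 1 at the matching place,
    an upper barrier. Once 0 \<le> \<open>y r\<close> < \<open>u r\<close> \<le> 1 is known
    throughout, the given digits are the greedy digits of \<open>y 0\<close>.\<close>
  define y where "y r = (\<Sum>m. real (\<delta> (r + m)) / \<beta> ^ Suc m)" for r
  define u where "u r = orb \<beta> 1 (pos r)" for r
  have y_nonneg: "0 \<le> y r" for r
    unfolding y_def using \<beta> by (intro suminf_nonneg summ) simp
  have y_le: "y r \<le> (\<Sum>m. real k * (1 / \<beta>) ^ m)" for r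
    unfolding y_def
  proof (intro suminf_le summ summable_mult summable_geometric)
    fix m
    have "real (\<delta> (r + m)) / \<beta> ^ Suc m \<le> real k / \<beta> ^ m"
      using \<beta> \<delta>_le[of "r + m"] by (intro frac_le) auto
    then show "real (\<delta> (r + m)) / \<beta> ^ Suc m \<le> real k * (1 / \<beta>) ^ m"
      by (simp add: power_one_over)
  qed (use \<beta> in simp)
  have y_rec: "\<beta> * y r = real (\<delta> r) + y (Suc r)" for r
  proof -
    have "y r = real (\<delta> r) / \<beta> + (\<Sum>m. real (\<delta> (r + Suc m)) / \<beta> ^ Suc (Suc m))"
      unfolding y_def using suminf_split_head[OF summ[of r]] by simp
    also have "(\<Sum>m. real (\<delta> (r + Suc m)) / \<beta> ^ Suc (Suc m)) = (\<Sum>m. real (\<delta> (Suc r + m)) / \<beta> ^ Suc m / \<beta>)"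
      by (simp add: mult.commute)
    also have "\<dots> = y (Suc r) / \<beta>"
      unfolding y_def by (rule suminf_divide[OF summ])
    finally show ?thesis
      using \<beta> by (simp add: field_simps)
  qed
  have u_nonneg: "0 \<le> u r" for r
    unfolding u_def by (rule orb_nonneg) simp
  have u_le: "u r \<le> 1" for r
    unfolding u_def by (rule orb_le_1) simp
  have u_rec: "\<beta> * u r = real (beta_digit \<beta> 1 (pos r)) + orb \<beta> 1 (Suc (pos r))" for r
    unfolding u_def using \<beta> by (intro digit_plus_orb) auto
  \<comment> \<open>At the end of a block the digit is smaller by at least 1, which makes up for
    \<open>u\<close> jumping back to 1. Strictness comes from the orbit of 1 avoiding 0.\<close>
  have u_end: "real (\<delta> r) + u (Suc r) < \<beta> * u r" if "pos (Suc r) = 0" for r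
  proof -
    have "\<delta> r < beta_digit \<beta> 1 (pos r)"
      using step[of r] that by auto
    moreover have "0 < orb \<beta> 1 (Suc (pos r))"
      using nonzero orb_Suc_nonneg order_le_less by metis
    ultimately show ?thesis
      unfolding u_rec using u_le[of "Suc r"] by linarith
  qed
  have u_mid: "real (\<delta> r) + u (Suc r) = \<beta> * u r" if "pos (Suc r) \<noteq> 0" for r
    using step[of r] that u_rec[of r] by (auto simp: u_def)
  \<comment> \<open>A positive excess of \<open>y\<close> over \<open>u\<close> would grow at least
    geometrically, against the uniform bound on \<open>y\<close>.\<close>
  have contract: "\<beta> * (y r - u r) \<le> y (Suc r) - u (Suc r)" for r
    using u_end[of r] u_mid[of r] y_rec[of r] by (cases "pos (Suc r) = 0") (auto simp: right_diff_distrib)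
  have y_le_u: "y r \<le> u r" for r
  proof (rule ccontr)
    assume "\<not> y r \<le> u r"
    then have pos: "0 < y r - u r" by simp
    have grow: "\<beta> ^ m * (y r - u r) \<le> y (r + m) - u (r + m)" for m
    proof (induction m)
      case (Suc m)
      have "\<beta> ^ Suc m * (y r - u r) \<le> \<beta> * (y (r + m) - u (r + m))"
        using Suc \<beta> by (simp add: mult.assoc)
      also have "\<dots> \<le> y (r + Suc m) - u (r + Suc m)"
        using contract[of "r + m"] by simp
      finally show ?case .
    qed simp
    define K where "K = (\<Sum>m. real k * (1 / \<beta>) ^ m)"
    obtain m where "K / (y r - u r) < \<beta> ^ m"
      using real_arch_pow[OF \<beta>] by blast
    then have "K < \<beta> ^ m * (y r - u r)"
      using pos by (simp add: field_simps)
    also have "\<dots> \<le> y (r + m)"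
      using grow[of m] u_nonneg[of "r + m"] by simp
    also have "\<dots> \<le> K"
      using y_le unfolding K_def .
    finally show False by simp
  qed
  \<comment> \<open>Strictness arises at the end of a block and is carried back to its earlier
    positions; every block ends because \<open>pos\<close> stays below \<open>n\<close>.\<close>
  have y_less_u: "y r < u r" for r
  proof (induction "n - pos r" arbitrary: r rule: less_induct)
    case less
    have "real (\<delta> r) + y (Suc r) < \<beta> * u r"
    proof (cases "pos (Suc r) = 0")
      case True
      then show ?thesis
        using u_end[of r] y_le_u[of "Suc r"] by simp
    next
      case False
      then have "n - pos (Suc r) < n - pos r"
        using step[of r] bounded[of r] by auto
      then show ?thesis
        using less[of "Suc r"] u_mid[OF False] by simp
    qed
    then show ?case
      using y_rec[of r] \<beta> by (metis mult_less_cancel_left_pos less_trans zero_less_one)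
  qed
  then have y_less_1: "y r < 1" for r
    using u_le order_less_le_trans by blast
  have orb_y: "orb \<beta> (y 0) r = y r" for r
  proof (induction r)
    case (Suc r)
    then show ?case
      using beta_digit_eqI(2)[of \<beta> "y 0" r] y_rec[of r] y_nonneg y_less_1 by simp
  qed simp
  have "beta_digit \<beta> (y 0) r = \<delta> r" for r
    using beta_digit_eqI(1)[of \<beta> "y 0" r] y_rec[of r] y_nonneg y_less_1 orb_y by simp
  then show ?thesis
    using that y_nonneg y_less_1 by blast
qed

text \<open>Otherwise all block frequencies, and with them their hull, would lie in an open
  half-space with \<open>\<alpha>\<close> on its boundary, although \<open>\<alpha>\<close> is in
  the hull.\<close>

lemma inner_block_exists:
  fixes \<alpha> D :: "real ^ 'k::finite"
  assumes "\<alpha> \<in> convex hull (block_freqs lab \<beta> n)"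
  shows "\<exists>b\<in>blocks \<beta> n. D \<bullet> (block_vec lab \<beta> b - real (Suc (fst b)) *\<^sub>R \<alpha>) \<le> 0"
proof (rule ccontr)
  assume neg: "\<not> ?thesis"
  have "block_freqs lab \<beta> n \<subseteq> {q. D \<bullet> q > D \<bullet> \<alpha>}"
  proof
    fix q assume "q \<in> block_freqs lab \<beta> n"
    then obtain b where b: "b \<in> blocks \<beta> n" "q = block_vec lab \<beta> b /\<^sub>R real (Suc (fst b))"
      by (auto simp: block_freqs_def)
    have "real (Suc (fst b)) * (D \<bullet> \<alpha>) < D \<bullet> block_vec lab \<beta> b"
      using neg b(1) by (auto simp: inner_diff_right not_le simp del: of_nat_Suc)
    then show "q \<in> {q. D \<bullet> q > D \<bullet> \<alpha>}"
      by (simp add: b(2) field_simps del: of_nat_Suc)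
  qed
  then have "convex hull (block_freqs lab \<beta> n) \<subseteq> {q. D \<bullet> q > D \<bullet> \<alpha>}"
    by (intro hull_minimal convex_halfspace_gt)
  with assms show False by auto
qed

text \<open>Greedy scheduling: always starting a block whose deviation vector makes an obtuse angle with the
  deviation \<open>D\<close> accumulated so far makes the squared norm of \<open>D\<close> grow at most linearly.\<close>

lemma balanced_block_sequence:
  fixes \<alpha> :: "real ^ 'k::finite"
  assumes hull: "\<alpha> \<in> convex hull (block_freqs lab \<beta> n)"
  obtains \<delta> pos :: "nat \<Rightarrow> nat" where
    "pos 0 = 0" "\<And>r. pos r < n"
    "\<And>r. \<delta> r = beta_digit \<beta> 1 (pos r) \<and> pos (Suc r) = Suc (pos r) \<or>
      \<delta> r < beta_digit \<beta> 1 (pos r) \<and> pos (Suc r) = 0"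
    "(\<lambda>r. (\<Sum>q<r. digit_unit lab (\<delta> q)) /\<^sub>R real r) \<longlonglongrightarrow> \<alpha>"
proof -
  define v where "v b = block_vec lab \<beta> b - real (Suc (fst b)) *\<^sub>R \<alpha>" for b
  obtain sel where sel: "\<And>D. sel D \<in> blocks \<beta> n" "\<And>D. D \<bullet> v (sel D) \<le> 0"
    using inner_block_exists[OF hull] unfolding v_def by metis
  \<comment> \<open>In a state \<open>(i, b, D)\<close>, \<open>i\<close> digits of the current
    block \<open>b\<close> have been written, and \<open>D\<close> is the deviation of all digits so
    far.\<close>
  define digit where "digit = (\<lambda>(i, b, D::real^'k). if i < fst b then beta_digit \<beta> 1 i else snd b)"
  define dev where "dev = (\<lambda>(i, b, D). D + digit_unit lab (digit (i, b, D)) - \<alpha>)"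
  define step where "step = (\<lambda>(i, b, D). if i < fst b then (Suc i, b, dev (i, b, D))
    else (0, sel (dev (i, b, D)), dev (i, b, D)))"
  define st where "st r = (step ^^ r) (0, sel 0, 0)" for r
  have st_0: "st 0 = (0, sel 0, 0)" and st_Suc: "st (Suc r) = step (st r)" for r
    by (simp_all add: st_def)
  have "finite (v ` blocks \<beta> n)"
    by (simp add: finite_blocks)
  then obtain M where M: "\<And>b. b \<in> blocks \<beta> n \<Longrightarrow> norm (v b) \<le> M"
    using finite_imp_bounded bounded_iff by (metis imageI)
  have "0 \<le> M"
    using M[OF sel(1)[of 0]] norm_ge_zero order_trans by blast
  define part where "part i = count_vec lab \<beta> 1 i - real i *\<^sub>R \<alpha>" for i
  \<comment> \<open>\<open>D0\<close> is the deviation when the current block began, and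
    \<open>part i\<close> is what its first \<open>i\<close> digits added. The bound uses the number
    of digits, which is at least the number of completed blocks.\<close>
  define inv where "inv r = (\<lambda>(i, b, D). b \<in> blocks \<beta> n \<and> i \<le> fst b \<and>
    (\<exists>D0. D = D0 + part i \<and> D0 \<bullet> v b \<le> 0 \<and> (norm D0)\<^sup>2 \<le> M\<^sup>2 * real r))" for r
  have inv: "inv r (st r)" for r
  proof (induction r)
    case 0
    show ?case
      using sel by (auto simp: st_0 inv_def part_def)
  next
    case (Suc r)
    obtain i b D where st: "st r = (i, b, D)"
      by (cases "st r") auto
    with Suc obtain D0 where b: "b \<in> blocks \<beta> n" "i \<le> fst b"
      and D: "D = D0 + part i" "D0 \<bullet> v b \<le> 0" "(norm D0)\<^sup>2 \<le> M\<^sup>2 * real r"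
      by (auto simp: inv_def)
    show ?case
    proof (cases "i < fst b")
      case True
      have "dev (i, b, D) = D0 + part (Suc i)"
        using True D by (simp add: dev_def digit_def part_def count_vec_Suc algebra_simps)
      moreover have "(norm D0)\<^sup>2 \<le> M\<^sup>2 * real (Suc r)"
        using D(3) by (simp add: algebra_simps add_increasing)
      ultimately show ?thesis
        using True b D(2) by (auto simp: st_Suc st step_def inv_def)
    next
      case False
      then have "i = fst b"
        using b by simp
      then have dev: "dev (i, b, D) = D0 + v b"
        using D by (simp add: dev_def digit_def part_def v_def block_vec_def algebra_simps)
      \<comment> \<open>The choice of \<open>b\<close> makes the cross term nonpositive, so a
        completed block adds at most \<open>M\<^sup>2\<close>.\<close>
      have "(norm (D0 + v b))\<^sup>2 = (norm D0)\<^sup>2 + (norm (v b))\<^sup>2 + 2 * (D0 \<bullet> v b)"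
        by (simp add: power2_norm_eq_inner inner_add_left inner_add_right inner_commute)
      also have "\<dots> \<le> M\<^sup>2 * real r + M\<^sup>2"
        using D M[OF b(1)] power_mono[of "norm (v b)" M 2] by simp
      finally have "(norm (D0 + v b))\<^sup>2 \<le> M\<^sup>2 * real (Suc r)"
        by (simp add: algebra_simps)
      then show ?thesis
        using False sel by (auto simp: st_Suc st step_def inv_def dev part_def)
    qed
  qed
  define pos where "pos r = fst (st r)" for r
  define \<delta> where "\<delta> r = digit (st r)" for r
  have pos_0: "pos 0 = 0"
    by (simp add: pos_def st_0)
  have pos_less: "pos r < n" for r
    using inv[of r] by (cases "st r") (auto simp: inv_def pos_def blocks_def)
  have pos_step: "\<delta> r = beta_digit \<beta> 1 (pos r) \<and> pos (Suc r) = Suc (pos r) \<or>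
      \<delta> r < beta_digit \<beta> 1 (pos r) \<and> pos (Suc r) = 0" for r
    using inv[of r] by (cases "st r") (auto simp: inv_def pos_def \<delta>_def digit_def st_Suc step_def blocks_def)
  have dev_sum: "snd (snd (st r)) = (\<Sum>q<r. digit_unit lab (\<delta> q)) - real r *\<^sub>R \<alpha>" for r
  proof (induction r)
    case (Suc r)
    obtain i b D where st: "st r = (i, b, D)"
      by (cases "st r") auto
    have "snd (snd (st (Suc r))) = D + digit_unit lab (\<delta> r) - \<alpha>"
      by (simp add: st_Suc st step_def dev_def \<delta>_def)
    moreover have "D = (\<Sum>q<r. digit_unit lab (\<delta> q)) - real r *\<^sub>R \<alpha>"
      using Suc by (simp add: st)
    ultimately show ?case
      by (simp add: algebra_simps)
  qed (simp add: st_0)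
  have "finite (part ` {..<n})"
    by simp
  then obtain K where K: "\<And>i. i < n \<Longrightarrow> norm (part i) \<le> K"
    using finite_imp_bounded bounded_iff by (metis imageI lessThan_iff)
  have bound: "norm ((\<Sum>q<r. digit_unit lab (\<delta> q)) - real r *\<^sub>R \<alpha>) \<le> M * sqrt (real r) + K" for r
  proof -
    obtain i b D where st: "st r = (i, b, D)"
      by (cases "st r") auto
    with inv[of r] obtain D0 where D: "D = D0 + part i" "(norm D0)\<^sup>2 \<le> M\<^sup>2 * real r"
      by (auto simp: inv_def)
    have "norm D0 \<le> sqrt (M\<^sup>2 * real r)"
      using D(2) by (rule real_le_rsqrt)
    also have "\<dots> = M * sqrt (real r)"
      using \<open>0 \<le> M\<close> by (simp add: real_sqrt_mult)
    finally have "norm D \<le> M * sqrt (real r) + K"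
      unfolding D(1) using K[of i] pos_less[of r] st
      by (intro norm_triangle_mono) (auto simp: pos_def)
    then show ?thesis
      using dev_sum[of r] by (simp add: st)
  qed
  have lim: "(\<lambda>r. (\<Sum>q<r. digit_unit lab (\<delta> q)) /\<^sub>R real r) \<longlonglongrightarrow> \<alpha>"
  proof (rule LIM_zero_cancel, rule tendsto_norm_zero_cancel, rule tendsto_sandwich[OF _ _ tendsto_const])
    show "\<forall>\<^sub>F r in sequentially. norm ((\<Sum>q<r. digit_unit lab (\<delta> q)) /\<^sub>R real r - \<alpha>)
        \<le> (M * sqrt (real r) + K) / real r"
    proof (rule eventually_sequentiallyI)
      fix r :: nat assume "1 \<le> r"
      then have "(\<Sum>q<r. digit_unit lab (\<delta> q)) /\<^sub>R real r - \<alpha>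
          = ((\<Sum>q<r. digit_unit lab (\<delta> q)) - real r *\<^sub>R \<alpha>) /\<^sub>R real r"
        by (simp add: scaleR_diff_right)
      then show "norm ((\<Sum>q<r. digit_unit lab (\<delta> q)) /\<^sub>R real r - \<alpha>) \<le> (M * sqrt (real r) + K) / real r"
        using bound[of r] by (simp add: divide_inverse mult.commute mult_left_mono)
    qed
    have "(\<lambda>r. M * inverse (sqrt (real r)) + K * inverse (real r)) \<longlonglongrightarrow> M * 0 + K * 0"
      by (intro tendsto_intros tendsto_inverse_0_at_top filterlim_real_sequentially
          filterlim_compose[OF sqrt_at_top filterlim_real_sequentially])
    moreover have "(\<lambda>r. M * inverse (sqrt (real r)) + K * inverse (real r))
        = (\<lambda>r. (M * sqrt (real r) + K) / real r)"
      by (simp add: fun_eq_iff divide_inverse distrib_right flip: sqrt_divide_self_eq)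
    ultimately show "(\<lambda>r. (M * sqrt (real r) + K) / real r) \<longlonglongrightarrow> 0"
      by simp
  qed simp
  show ?thesis
    using that[OF pos_0 pos_less pos_step lim] .
qed

lemma hull_has_frequency:
  fixes \<alpha> :: "real ^ 'k::finite"
  assumes "1 < \<beta>" "\<And>r. orb \<beta> 1 r \<noteq> 0" "\<alpha> \<in> convex hull (block_freqs lab \<beta> n)"
  shows "\<exists>x\<in>{0..1}. has_digit_frequency lab \<beta> x \<alpha>"
proof -
  obtain \<delta> pos :: "nat \<Rightarrow> nat" where seq: "pos 0 = 0" "\<And>r. pos r < n"
    "\<And>r. \<delta> r = beta_digit \<beta> 1 (pos r) \<and> pos (Suc r) = Suc (pos r) \<or>
      \<delta> r < beta_digit \<beta> 1 (pos r) \<and> pos (Suc r) = 0"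
    "(\<lambda>r. (\<Sum>q<r. digit_unit lab (\<delta> q)) /\<^sub>R real r) \<longlonglongrightarrow> \<alpha>"
    by (rule balanced_block_sequence[OF assms(3)]) (rule that, assumption+)
  obtain x where x: "0 \<le> x" "x < 1" "\<And>r. beta_digit \<beta> x r = \<delta> r"
    by (rule realize_block_sequence[OF assms(1,2) seq(1-3)]) (rule that, assumption+)
  have "has_digit_frequency lab \<beta> x \<alpha>"
    using seq(4) unfolding has_digit_frequency_count_vec count_vec_def x(3) .
  then show ?thesis
    using x by (intro bexI[of _ x]) auto
qed

subsection \<open>A sufficient condition on the expansion of 1\<close>

text \<open>\<open>resets w p\<close> says that \<open>w\<^sub>1 \<dots> w\<^sub>p\<^sub>-\<^sub>1\<close> is a concatenation of blocks.\<close>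

inductive resets :: "(nat \<Rightarrow> nat) \<Rightarrow> nat \<Rightarrow> bool" for w where
  resets_1: "resets w 1"
| resets_block: "resets w p \<Longrightarrow> (\<forall>i<s. w (p + i) = w i) \<Longrightarrow> w (p + s) < w s \<Longrightarrow> resets w (Suc (p + s))"

lemma resets_pos: "resets w p \<Longrightarrow> 0 < p"
  by (induction rule: resets.induct) auto

text \<open>Only letters before position \<open>p\<close> are inspected. This permits passing
  between an infinite expansion and a list, whose entries past the end are unspecified.\<close>

lemma resets_cong:
  "resets w p \<Longrightarrow> (\<And>i. i < p \<Longrightarrow> w i = w' i) \<Longrightarrow> resets w' p"
proof (induction rule: resets.induct)
  case (resets_block p s)
  have "resets w' p"
    using resets_block by simp
  moreover have "\<forall>i<s. w' (p + i) = w' i"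
    using resets_block.hyps(2) resets_block.prems
    by (metis add_strict_left_mono less_Suc_eq trans_less_add2)
  moreover have "w' (p + s) < w' s"
    using resets_block.hyps(3) resets_block.prems[of "p + s"] resets_block.prems[of s] by simp
  ultimately show ?case
    by (rule resets.resets_block)
qed (rule resets_1)

text \<open>At a reset the orbit of 1 is below 1, so its first mismatch with the expansion of 1
  completes another block and gives a later reset.\<close>

lemma resets_unbounded:
  assumes "1 < \<beta>"
  shows "\<exists>p\<ge>N. resets (beta_digit \<beta> 1) p"
proof (induction N)
  case 0
  show ?case
    using resets_1 by blast
next
  case (Suc N)
  then obtain p where p: "p \<ge> N" "resets (beta_digit \<beta> 1) p"
    by blast
  have "orb \<beta> 1 p < 1"
    using orb_Suc_less_1[of \<beta> 1 "p - 1"] resets_pos[OF p(2)] by simp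
  then obtain s where s: "\<And>i. i < s \<Longrightarrow> beta_digit \<beta> (orb \<beta> 1 p) i = beta_digit \<beta> 1 i"
    "beta_digit \<beta> (orb \<beta> 1 p) s < beta_digit \<beta> 1 s"
    using first_mismatch[OF assms orb_nonneg[of 1 \<beta> p]] by (metis order_refl zero_le_one)
  then have "resets (beta_digit \<beta> 1) (Suc (p + s))"
    using p(2) by (intro resets_block) (auto simp: beta_digit_shift)
  then show ?case
    using p(1) by (intro exI[of _ "Suc (p + s)"]) simp
qed

lemma resets_count_vec:
  assumes "resets (beta_digit \<beta> 1) p" "1 \<le> \<beta>"
  shows "\<exists>c\<in>block_cone lab \<beta> p. count_vec lab \<beta> 1 p = digit_unit lab (beta_digit \<beta> 1 0) + c"
  using assms(1)
proof (induction rule: resets.induct)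
  case resets_1
  show ?case
    using zero_in_block_cone[of \<beta> 1 lab] assms(2)
    by (intro bexI[of _ 0]) (auto simp: count_vec_def)
next
  case (resets_block p s)
  then obtain c where c: "c \<in> block_cone lab \<beta> p"
    "count_vec lab \<beta> 1 p = digit_unit lab (beta_digit \<beta> 1 0) + c"
    by blast
  let ?b = "(s, beta_digit \<beta> 1 (p + s))"
  have "count_vec lab \<beta> (orb \<beta> 1 p) s = count_vec lab \<beta> 1 s"
    using resets_block by (intro count_vec_cong) (simp add: beta_digit_shift)
  then have "count_vec lab \<beta> (orb \<beta> 1 p) (Suc s) = block_vec lab \<beta> ?b"
    by (simp add: count_vec_Suc block_vec_def beta_digit_shift)
  then have "count_vec lab \<beta> 1 (Suc (p + s)) = digit_unit lab (beta_digit \<beta> 1 0) + (c + block_vec lab \<beta> ?b)"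
    using count_vec_add[of lab \<beta> 1 p "Suc s"] c(2) by simp
  moreover have "c \<in> block_cone lab \<beta> (Suc (p + s))"
    using c(1) block_cone_mono[of p "Suc (p + s)" lab \<beta>] by auto
  moreover have "block_vec lab \<beta> ?b \<in> block_cone lab \<beta> (Suc (p + s))"
    using resets_block resets_pos by (intro block_vec_in_cone) (auto simp: blocks_def)
  ultimately show ?case
    using block_cone_add by blast
qed

text \<open>The leading digit \<open>w\<^sub>0\<close> is absorbed by combining it with \<open>j\<close> zeros into the block \<open>w\<^sub>0 0\<^sup>j\<close>.\<close>

lemma prefix_in_cone:
  assumes "1 \<le> \<beta>" "0 < j" "\<And>i. 0 < i \<Longrightarrow> i < j \<Longrightarrow> beta_digit \<beta> 1 i = 0" "0 < beta_digit \<beta> 1 j"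
    and "resets (beta_digit \<beta> 1) p" "\<And>i. i < j \<Longrightarrow> beta_digit \<beta> 1 (p + i) = 0"
  shows "count_vec lab \<beta> 1 (p + j) \<in> block_cone lab \<beta> (p + j)"
proof -
  obtain c where c: "c \<in> block_cone lab \<beta> p"
    "count_vec lab \<beta> 1 p = digit_unit lab (beta_digit \<beta> 1 0) + c"
    using resets_count_vec[OF assms(5,1)] by blast
  have "count_vec lab \<beta> (orb \<beta> 1 p) j = real j *\<^sub>R digit_unit lab 0"
    using assms(6) by (simp add: count_vec_def beta_digit_shift sum_constant_scaleR del: sum_constant)
  moreover have "count_vec lab \<beta> 1 i = digit_unit lab (beta_digit \<beta> 1 0) + (real i - 1) *\<^sub>R digit_unit lab 0"
    if "0 < i" "i \<le> j" for i
    using that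
  proof (induction i)
    case (Suc i)
    then show ?case
      using assms(3)[of i] by (cases "i = 0") (simp_all add: count_vec_Suc algebra_simps)
  qed simp
  \<comment> \<open>The word \<open>w\<^sub>0 0\<^sup>j\<close> is the block \<open>(j, 0)\<close>:
    its first \<open>j\<close> letters agree with the expansion of 1, and its last letter 0 is below
    digit \<open>j\<close>.\<close>
  then have "block_vec lab \<beta> (j, 0) = digit_unit lab (beta_digit \<beta> 1 0) + real j *\<^sub>R digit_unit lab 0"
    using assms(2) by (simp add: block_vec_def algebra_simps)
  ultimately have "count_vec lab \<beta> 1 (p + j) = c + block_vec lab \<beta> (j, 0)"
    by (simp add: count_vec_add c(2))
  moreover have "c \<in> block_cone lab \<beta> (p + j)"
    using c(1) block_cone_mono[of p "p + j" lab \<beta>] by auto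
  moreover have "block_vec lab \<beta> (j, 0) \<in> block_cone lab \<beta> (p + j)"
    using assms(4) resets_pos[OF assms(5)] by (intro block_vec_in_cone) (auto simp: blocks_def)
  ultimately show ?thesis
    using block_cone_add by metis
qed

lemma exists_nonzero_digit:
  assumes "1 < \<beta>" "orb \<beta> 1 1 \<noteq> 0"
  obtains j where "0 < j" "\<And>i. 0 < i \<Longrightarrow> i < j \<Longrightarrow> beta_digit \<beta> 1 i = 0" "0 < beta_digit \<beta> 1 j"
proof -
  have y: "0 < orb \<beta> 1 1" "orb \<beta> 1 1 \<le> 1"
    using assms(2) orb_Suc_nonneg[of \<beta> 1 0] orb_Suc_less_1[of \<beta> 1 0] by auto
  \<comment> \<open>A digit exceeding a digit of 0 is positive; starting from the first orbit point
    keeps the leading digit out of consideration.\<close>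
  obtain s where "beta_digit \<beta> 0 s < beta_digit \<beta> (orb \<beta> 1 1) s"
    using first_mismatch[OF assms(1) order_refl y] by blast
  then have "\<exists>j. 0 < j \<and> 0 < beta_digit \<beta> 1 j"
    by (intro exI[of _ "Suc s"]) (simp add: beta_digit_shift)
  then obtain j where j: "0 < j" "0 < beta_digit \<beta> 1 j"
    "\<And>i. i < j \<Longrightarrow> \<not> (0 < i \<and> 0 < beta_digit \<beta> 1 i)"
    using exists_least_iff[of "\<lambda>j. 0 < j \<and> 0 < beta_digit \<beta> 1 j"] by auto
  then show ?thesis
    using that[of j] by auto
qed

text \<open>Runs of zeros of every length are assumed because the length \<open>j\<close> that is
  needed depends on \<open>\<beta>\<close>. The orbit avoiding 0 serves both to find
  \<open>j\<close> and to realize the frequencies.\<close>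

lemma DF_eq_hull:
  fixes lab :: "'k::finite \<Rightarrow> nat"
  assumes lab: "bij_betw lab UNIV {..<k}" and \<beta>: "1 < \<beta>" "\<beta> < real k"
    and nonzero: "\<And>r. orb \<beta> 1 r \<noteq> 0"
    and resets: "\<And>j. \<exists>p. resets (beta_digit \<beta> 1) p \<and> (\<forall>i<j. beta_digit \<beta> 1 (p + i) = 0)"
  shows "\<exists>n. DF lab \<beta> = convex hull (block_freqs lab \<beta> n)"
proof -
  obtain j where j: "0 < j" "\<And>i. 0 < i \<Longrightarrow> i < j \<Longrightarrow> beta_digit \<beta> 1 i = 0" "0 < beta_digit \<beta> 1 j"
    using exists_nonzero_digit[OF \<beta>(1) nonzero] by blast
  obtain p where p: "resets (beta_digit \<beta> 1) p" "\<And>i. i < j \<Longrightarrow> beta_digit \<beta> 1 (p + i) = 0"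
    using resets by blast
  have cone: "count_vec lab \<beta> 1 (p + j) \<in> block_cone lab \<beta> (p + j)"
    using \<beta> j p by (intro prefix_in_cone) auto
  have "DF lab \<beta> \<subseteq> convex hull (block_freqs lab \<beta> (p + j))"
    using frequency_in_hull[OF lab \<beta> _ cone] j(1) by (auto simp: DF_def)
  moreover have "convex hull (block_freqs lab \<beta> (p + j)) \<subseteq> DF lab \<beta>"
    using hull_has_frequency[OF \<beta>(1) nonzero] block_freqs_subset_simplex[OF lab _ \<beta>(2)] \<beta>
    by (fastforce simp: DF_def)
  ultimately show ?thesis by blast
qed

subsection \<open>Almost every parameter satisfies the condition\<close>

text \<open>\<open>orb_poly w n\<close> is the polynomial in \<open>\<beta>\<close> that computes the \<open>n\<close>-th point of the orbit of 1 on the set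
  of those \<open>\<beta>\<close> whose first \<open>n\<close> digits are given by \<open>w\<close>.\<close>

primrec orb_poly :: "(nat \<Rightarrow> nat) \<Rightarrow> nat \<Rightarrow> real \<Rightarrow> real" where
  "orb_poly w 0 x = 1"
| "orb_poly w (Suc n) x = x * orb_poly w n x - real (w n)"

lemma orb_poly_eq_orb:
  assumes "0 \<le> x" "\<And>i. i < n \<Longrightarrow> beta_digit x 1 i = w i"
  shows "orb_poly w n x = orb x 1 n"
  using assms(2)
proof (induction n)
  case (Suc n)
  then show ?case
    using digit_plus_orb[of x 1 n] assms(1) by simp
qed simp

lemma beta_digit_eq_of_orb_poly:
  assumes "0 \<le> x" "\<And>i. i < n \<Longrightarrow> 0 \<le> orb_poly w (Suc i) x" "\<And>i. i < n \<Longrightarrow> orb_poly w (Suc i) x < 1"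
    and "i < n"
  shows "beta_digit x 1 i = w i"
  using assms(4)
proof (induction i rule: less_induct)
  case (less i)
  have "orb_poly w i x = orb x 1 i"
    using less assms(1) by (intro orb_poly_eq_orb) auto
  then show ?case
    using assms(2,3)[of i] less.prems by (intro beta_digit_eqI(1)[where z = "orb_poly w (Suc i) x"]) auto
qed

lemma orb_poly_mono:
  assumes "0 \<le> x" "x \<le> y" "\<And>i. i \<le> n \<Longrightarrow> 0 \<le> orb_poly w i x"
  shows "orb_poly w n x \<le> orb_poly w n y"
  using assms(3)
proof (induction n)
  case (Suc n)
  then have "x * orb_poly w n x \<le> y * orb_poly w n y"
    using assms(1,2) by (intro mult_mono) auto
  then show ?case by simp
qed simp

text \<open>The exponent is \<open>n\<close> and not \<open>Suc n\<close> because the first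
  polynomial has slope 1. Each further step multiplies the increment by \<open>y\<close> and adds a
  nonnegative term.\<close>

lemma orb_poly_expand:
  assumes "1 \<le> b" "b \<le> x" "x \<le> y" "\<And>i. i \<le> Suc n \<Longrightarrow> 0 \<le> orb_poly w i x"
  shows "b ^ n * (y - x) \<le> orb_poly w (Suc n) y - orb_poly w (Suc n) x"
  using assms(4)
proof (induction n)
  case (Suc n)
  have IH: "b ^ n * (y - x) \<le> orb_poly w (Suc n) y - orb_poly w (Suc n) x"
    using Suc by auto
  have "b ^ Suc n * (y - x) = b * (b ^ n * (y - x))"
    by simp
  also have "\<dots> \<le> y * (orb_poly w (Suc n) y - orb_poly w (Suc n) x)"
    using IH assms(1-3) by (intro mult_mono) auto
  also have "\<dots> \<le> y * (orb_poly w (Suc n) y - orb_poly w (Suc n) x) + (y - x) * orb_poly w (Suc n) x"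
    using Suc.prems[of "Suc n"] assms(3) by simp
  also have "\<dots> = orb_poly w (Suc (Suc n)) y - orb_poly w (Suc (Suc n)) x"
    by (simp add: algebra_simps)
  finally show ?case .
qed simp

text \<open>Convexity as a comparison of chord slopes, with denominators cleared. It is inherited
  because multiplying a nonnegative, nondecreasing convex function by the variable keeps it convex
  on the nonnegative reals.\<close>

lemma orb_poly_convex:
  assumes "0 \<le> x" "x \<le> y" "y \<le> z" "\<And>i. i \<le> n \<Longrightarrow> 0 \<le> orb_poly w i x"
  shows "(orb_poly w n y - orb_poly w n x) * (z - y) \<le> (orb_poly w n z - orb_poly w n y) * (y - x)"
  using assms(4)
proof (induction n)
  case (Suc n)
  let ?P = "orb_poly w n"
  have xy: "?P x \<le> ?P y"
    using assms Suc.prems by (intro orb_poly_mono) auto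
  have pos: "0 \<le> orb_poly w i y" if "i \<le> n" for i
    using orb_poly_mono[of x y i w] assms Suc.prems that by (meson le_SucI order_trans)
  have yz: "?P y \<le> ?P z"
    using assms pos by (intro orb_poly_mono) auto
  have "(y * ?P y - x * ?P x) * (z - y) = y * ((?P y - ?P x) * (z - y)) + ?P x * ((y - x) * (z - y))"
    by (simp add: algebra_simps)
  also have "\<dots> \<le> z * ((?P z - ?P y) * (y - x)) + ?P y * ((y - x) * (z - y))"
  proof (rule add_mono)
    have "y * ((?P y - ?P x) * (z - y)) \<le> y * ((?P z - ?P y) * (y - x))"
      using Suc assms by (intro mult_left_mono) auto
    also have "\<dots> \<le> z * ((?P z - ?P y) * (y - x))"
      using yz assms by (intro mult_right_mono) auto
    finally show "y * ((?P y - ?P x) * (z - y)) \<le> z * ((?P z - ?P y) * (y - x))" .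
    show "?P x * ((y - x) * (z - y)) \<le> ?P y * ((y - x) * (z - y))"
      using xy assms by (intro mult_right_mono) auto
  qed
  also have "\<dots> = (z * ?P z - y * ?P y) * (y - x)"
    by (simp add: algebra_simps)
  finally show ?case by simp
qed simp

lemma continuous_on_orb_poly: "continuous_on S (orb_poly w n)"
proof (induction n)
  case (Suc n)
  then show ?case
    by (auto simp: fun_eq_iff intro!: continuous_intros)
qed (simp add: continuous_on_const)

text \<open>The root moves right as the word grows. At a root of one polynomial the next one is
  minus a digit, hence at most 0, while it is nonnegative at \<open>\<beta>\<close>; the
  intermediate value theorem gives its root. Monotonicity keeps the earlier polynomials nonnegative
  there.\<close>

lemma orb_poly_root:
  assumes "1 \<le> b" "b \<le> \<beta>" "\<And>i. i \<le> Suc n \<Longrightarrow> 0 \<le> orb_poly w i \<beta>" "real (w 0) = b"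
  shows "\<exists>a. b \<le> a \<and> a \<le> \<beta> \<and> orb_poly w (Suc n) a = 0 \<and> (\<forall>i\<le>Suc n. 0 \<le> orb_poly w i a)"
  using assms(3)
proof (induction n)
  case 0
  then show ?case
    using assms by (intro exI[of _ b]) (auto simp: le_Suc_eq)
next
  case (Suc n)
  then obtain a where a: "b \<le> a" "a \<le> \<beta>" "orb_poly w (Suc n) a = 0" "\<forall>i\<le>Suc n. 0 \<le> orb_poly w i a"
    by (metis le_SucI)
  have "orb_poly w (Suc (Suc n)) a \<le> 0" "0 \<le> orb_poly w (Suc (Suc n)) \<beta>"
    using a(3) Suc.prems[of "Suc (Suc n)"] by auto
  then obtain a' where a': "a \<le> a'" "a' \<le> \<beta>" "orb_poly w (Suc (Suc n)) a' = 0"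
    using IVT'[of "orb_poly w (Suc (Suc n))" a 0 \<beta>] a(2) continuous_on_orb_poly by blast
  have "0 \<le> orb_poly w i a'" if "i \<le> Suc n" for i
  proof -
    have "orb_poly w i a \<le> orb_poly w i a'"
      using a a'(1) that assms(1) by (intro orb_poly_mono) auto
    then show ?thesis
      using a(4) that by force
  qed
  then have "\<forall>i\<le>Suc (Suc n). 0 \<le> orb_poly w i a'"
    using a'(3) by (metis le_Suc_eq order_refl)
  then show ?case
    using a a' by (intro exI[of _ a']) auto
qed

section \<open>Cylinders: parameters with a given prefix\<close>

definition cylinder :: "nat \<Rightarrow> nat list \<Rightarrow> real set" where
  "cylinder k W = {\<beta>. real k - 1 < \<beta> \<and> \<beta> < real k \<and> (\<forall>i<length W. beta_digit \<beta> 1 i = W ! i)}"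

lemma digit_0_cylinder:
  assumes "\<beta> \<in> cylinder k W" "2 \<le> k"
  shows "beta_digit \<beta> 1 0 = k - 1"
proof -
  have "\<lfloor>\<beta>\<rfloor> = int k - 1"
    using assms by (intro floor_unique) (auto simp: cylinder_def)
  then show ?thesis
    by (simp add: beta_digit_orb nat_diff_distrib)
qed

text \<open>As long as the products stay below 1, each step is plain multiplication by
  \<open>\<beta>\<close> with digit 0. Using \<open>c\<close> in place of \<open>\<beta>\<close>
  makes the condition uniform over a cylinder.\<close>

lemma zero_digits:
  assumes "1 \<le> \<beta>" "\<beta> \<le> c" "0 \<le> y" "y * c ^ j < 1" "i < j"
  shows "beta_digit \<beta> y i = 0"
  using assms(3-5)
proof (induction j arbitrary: y i)
  case (Suc j)
  have "\<beta> * y * c ^ j \<le> y * c ^ Suc j"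
    using assms Suc.prems by (simp add: mult_mono mult_ac mult_left_mono)
  then have small: "\<beta> * y * c ^ j < 1"
    using Suc.prems by simp
  have "1 \<le> c ^ j"
    using assms by (intro one_le_power) simp
  then have "\<beta> * y \<le> \<beta> * y * c ^ j"
    using mult_left_mono[of 1 "c ^ j" "\<beta> * y"] assms(1) Suc.prems(1) by simp
  with small have "\<beta> * y < 1"
    by simp
  then have d: "beta_digit \<beta> y 0 = 0" "orb \<beta> y (Suc 0) = \<beta> * y"
    using beta_digit_eqI[of \<beta> y 0 0 "\<beta> * y"] assms(1) Suc.prems by auto
  show ?case
  proof (cases i)
    case (Suc i')
    have "beta_digit \<beta> (\<beta> * y) i' = 0"
      using Suc small Suc.prems Suc.IH[of "\<beta> * y" i'] assms(1) by simp
    then show ?thesis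
      using beta_digit_shift[of \<beta> y "Suc 0" i'] d(2) Suc by simp
  qed (simp add: d)
qed simp

text \<open>The left endpoint of a cylinder is a zero of the orbit polynomial, which is convex and at most 1
  there; so it is below \<open>1/k\<^sup>j\<close> on at least the fraction \<open>1/k\<^sup>j\<close> of the cylinder.\<close>

lemma cylinder_structure:
  assumes "2 \<le> k" "W \<noteq> []" "cylinder k W \<noteq> {}"
  obtains a b where "a \<le> b" "{a<..<b} \<subseteq> cylinder k W" "cylinder k W \<subseteq> {a..b}"
    "{a<..<a + (b - a) / real k ^ j} \<subseteq> cylinder k (W @ replicate j 0)"
proof -
  note orb_poly.simps(2) [simp del]
  let ?I = "cylinder k W"
  obtain n where n: "length W = Suc n"
    using assms(2) by (cases W) auto
  define w where "w = (\<lambda>i. W ! i)"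
  let ?P = "orb_poly w"
  obtain \<beta>0 where \<beta>0: "\<beta>0 \<in> ?I"
    using assms(3) by blast
  have I: "real k - 1 < \<beta>" "\<beta> < real k" if "\<beta> \<in> ?I" for \<beta>
    using that by (auto simp: cylinder_def)
  have P_eq: "?P i \<beta> = orb \<beta> 1 i" if "\<beta> \<in> ?I" "i \<le> Suc n" for i \<beta>
    using that n assms(1) by (intro orb_poly_eq_orb) (auto simp: cylinder_def w_def)
  have w0: "real (w 0) = real k - 1"
    using digit_0_cylinder[OF \<beta>0 assms(1)] \<beta>0 assms n by (auto simp: cylinder_def w_def)
  obtain a where a: "real k - 1 \<le> a" "a \<le> \<beta>0" "?P (Suc n) a = 0" "\<And>i. i \<le> Suc n \<Longrightarrow> 0 \<le> ?P i a"
  proof -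
    have "\<exists>a. real k - 1 \<le> a \<and> a \<le> \<beta>0 \<and> ?P (Suc n) a = 0 \<and> (\<forall>i\<le>Suc n. 0 \<le> ?P i a)"
      using w0 assms(1) P_eq[OF \<beta>0] I[OF \<beta>0] orb_nonneg[of 1 \<beta>0]
      by (intro orb_poly_root) auto
    then show ?thesis
      using that by blast
  qed
  have nonneg: "0 \<le> ?P i x" if "a \<le> x" "i \<le> Suc n" for i x
    using orb_poly_mono[of a x i w] a assms(1) that by force
  have less: "?P (Suc i) \<beta> < 1" if "\<beta> \<in> ?I" "i \<le> n" for i \<beta>
    using P_eq[OF that(1), of "Suc i"] orb_Suc_less_1[of \<beta> 1 i] that by simp
  \<comment> \<open>The polynomial increases strictly from a cylinder point to the right, so at a
    point left of \<open>a\<close> it would be negative, though it equals an orbit point.\<close>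
  have lower: "a \<le> x" if x: "x \<in> ?I" for x
  proof (rule ccontr)
    assume "\<not> a \<le> x"
    then have "(real k - 1) ^ n * (a - x) \<le> ?P (Suc n) a - ?P (Suc n) x"
      using I[OF x] P_eq[OF x] orb_nonneg[of 1 x] assms(1) \<open>\<not> a \<le> x\<close> by (intro orb_poly_expand) auto
    moreover have "0 < (real k - 1) ^ n * (a - x)"
      using \<open>\<not> a \<le> x\<close> assms(1) by simp
    moreover have "0 \<le> ?P (Suc n) x"
      using P_eq[OF x] orb_nonneg[of 1 x] by simp
    ultimately show False
      using a(3) by simp
  qed
  \<comment> \<open>By monotonicity the lower bounds pass from \<open>a\<close> to \<open>x\<close>
    and the upper bounds from \<open>\<beta>\<close> to \<open>x\<close>, so the cylinder has no
    gaps.\<close>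
  have between: "x \<in> ?I" if "a < x" "x \<le> \<beta>" "\<beta> \<in> ?I" for x \<beta>
  proof -
    have x: "real k - 1 < x" "x < real k" "0 \<le> x"
      using that a(1) I[OF that(3)] assms(1) by auto
    have "?P (Suc i) x < 1" if "i < Suc n" for i
    proof -
      have "?P (Suc i) x \<le> ?P (Suc i) \<beta>"
        using that \<open>a < x\<close> \<open>x \<le> \<beta>\<close> x by (intro orb_poly_mono nonneg) auto
      then show ?thesis
        using less[OF \<open>\<beta> \<in> ?I\<close>, of i] that by simp
    qed
    then have "beta_digit x 1 i = w i" if "i < Suc n" for i
      using that \<open>a < x\<close> x by (intro beta_digit_eq_of_orb_poly[where n = "Suc n"] nonneg) auto
    then show ?thesis
      using x n by (simp add: cylinder_def w_def)
  qed
  have bdd: "bdd_above ?I"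
    by (rule bdd_aboveI[of _ "real k"]) (auto simp: cylinder_def)
  define b where "b = Sup ?I"
  have upper: "x \<le> b" if "x \<in> ?I" for x
    unfolding b_def using that bdd by (rule cSup_upper)
  \<comment> \<open>The right end need not belong to the cylinder, so points close to it are used
    instead.\<close>
  have approx: "\<exists>\<beta>\<in>?I. x < \<beta>" if "x < b" for x
    using that less_cSup_iff[OF assms(3) bdd] unfolding b_def by blast
  show ?thesis
  proof (rule that)
    show "a \<le> b"
      using lower[OF \<beta>0] upper[OF \<beta>0] by simp
    show "{a<..<b} \<subseteq> ?I"
    proof
      fix x assume x: "x \<in> {a<..<b}"
      then obtain \<beta> where "\<beta> \<in> ?I" "x < \<beta>"
        using approx[of x] by auto
      then show "x \<in> ?I"
        using between[of x \<beta>] x by simp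
    qed
    show "?I \<subseteq> {a..b}"
      using lower upper by auto
    show "{a<..<a + (b - a) / real k ^ j} \<subseteq> cylinder k (W @ replicate j 0)"
    proof
      fix x assume x: "x \<in> {a<..<a + (b - a) / real k ^ j}"
      have kj: "1 \<le> real k ^ j"
        using assms(1) by simp
      have "(x - a) * real k ^ j < b - a"
      proof -
        have "x - a < (b - a) / real k ^ j"
          using x by simp
        then show ?thesis
          using pos_less_divide_eq[of "real k ^ j" "x - a" "b - a"] kj by linarith
      qed
      then obtain \<beta> where \<beta>: "\<beta> \<in> ?I" "a + (x - a) * real k ^ j < \<beta>"
        using approx[of "a + (x - a) * real k ^ j"] by (auto simp: algebra_simps)
      have "x - a \<le> (x - a) * real k ^ j"
        using x kj mult_left_mono[of 1 "real k ^ j" "x - a"] by simp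
      then have "x < \<beta>"
        using \<beta>(2) by simp
      then have xI: "x \<in> ?I"
        using between[OF _ _ \<beta>(1)] x by simp
      \<comment> \<open>The polynomial vanishes at \<open>a\<close>, so convexity puts its value at
        \<open>x\<close> below the chord from \<open>a\<close> to \<open>\<beta>\<close>, whose
        height at \<open>\<beta>\<close> is less than 1.\<close>
      have "?P (Suc n) x * (\<beta> - x) \<le> (?P (Suc n) \<beta> - ?P (Suc n) x) * (x - a)"
        using orb_poly_convex[of a x \<beta> "Suc n" w] a x \<open>x < \<beta>\<close> assms(1) by simp
      then have "?P (Suc n) x * (\<beta> - a) \<le> ?P (Suc n) \<beta> * (x - a)"
        by (simp add: algebra_simps)
      also have "\<dots> \<le> x - a"
        using less[OF \<beta>(1), of n] x by (simp add: mult_left_le_one_le mult_le_cancel_right1)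
      finally have "?P (Suc n) x * (\<beta> - a) * real k ^ j \<le> (x - a) * real k ^ j"
        using kj by (intro mult_right_mono) auto
      also have "\<dots> < \<beta> - a"
        using \<beta>(2) by simp
      finally have "?P (Suc n) x * real k ^ j * (\<beta> - a) < 1 * (\<beta> - a)"
        by (simp add: mult_ac)
      moreover have "0 \<le> \<beta> - a"
        using \<open>x < \<beta>\<close> x by simp
      ultimately have "?P (Suc n) x * real k ^ j < 1"
        by (rule mult_right_less_imp_less)
      then have "orb x 1 (Suc n) * real k ^ j < 1"
        using P_eq[OF xI] by simp
      then have "beta_digit x (orb x 1 (Suc n)) i = 0" if "i < j" for i
        using that I[OF xI] assms(1) orb_Suc_nonneg
        by (intro zero_digits[where c = "real k" and j = j]) auto
      then have zero: "beta_digit x 1 (Suc n + i) = 0" if "i < j" for i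
        using that by (simp add: beta_digit_shift)
      have "beta_digit x 1 i = (W @ replicate j 0) ! i" if "i < Suc n + j" for i
        using xI that n zero[of "i - Suc n"] by (cases "i < Suc n") (auto simp: cylinder_def nth_append)
      then show "x \<in> cylinder k (W @ replicate j 0)"
        using xI n by (simp add: cylinder_def)
    qed
  qed
qed

text \<open>A nonempty cylinder of a nonempty word is an open interval together with some of its
  endpoints.\<close>

lemma cylinder_measurable [measurable]:
  assumes "2 \<le> k"
  shows "cylinder k W \<in> sets lebesgue"
proof -
  consider "W = []" | "cylinder k W = {}" | "W \<noteq> []" "cylinder k W \<noteq> {}"
    by blast
  then show ?thesis
  proof cases
    case 1
    then have "cylinder k W = {real k - 1<..<real k}"
      by (auto simp: cylinder_def)
    then show ?thesis by simp
  next
    case 2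
    then show ?thesis by simp
  next
    case 3
    then obtain a b where ab: "{a<..<b} \<subseteq> cylinder k W" "cylinder k W \<subseteq> {a..b}"
      using cylinder_structure[OF assms, of W 0] by metis
    have "{a..b} \<subseteq> {a<..<b} \<union> {a, b}"
      by auto
    with ab have "cylinder k W = {a<..<b} \<union> (cylinder k W \<inter> {a, b})"
      by blast
    moreover have "{a<..<b} \<union> (cylinder k W \<inter> {a, b}) \<in> sets lebesgue"
    proof (rule sets.Un)
      have "closed (cylinder k W \<inter> {a, b})"
        by (intro finite_imp_closed) simp
      then show "cylinder k W \<inter> {a, b} \<in> sets lebesgue"
        by (simp add: borel_closed)
    qed simp
    ultimately show ?thesis
      by metis
  qed
qed

lemma cylinder_proportion:
  assumes "2 \<le> k" "W \<noteq> []" "B \<in> sets lebesgue" "B \<inter> cylinder k (W @ replicate j 0) = {}"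
  shows "emeasure lebesgue (B \<inter> cylinder k W) \<le> ennreal (1 - 1 / real k ^ j) * emeasure lebesgue (cylinder k W)"
proof (cases "cylinder k W = {}")
  case False
  then obtain a b where ab: "a \<le> b" "{a<..<b} \<subseteq> cylinder k W" "cylinder k W \<subseteq> {a..b}"
    "{a<..<a + (b - a) / real k ^ j} \<subseteq> cylinder k (W @ replicate j 0)"
    using cylinder_structure[OF assms(1,2)] by metis
  define c where "c = a + (b - a) / real k ^ j"
  have kj: "1 \<le> real k ^ j"
    using assms(1) by simp
  have c: "a \<le> c" "c \<le> b"
  proof -
    have "(b - a) / real k ^ j \<le> b - a"
      using ab(1) kj by (simp add: divide_le_eq mult_le_cancel_left1)
    then show "c \<le> b" by (simp add: c_def)
    show "a \<le> c" using ab(1) by (simp add: c_def)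
  qed
  \<comment> \<open>\<open>B\<close> avoids the open left part, so to the left of \<open>c\<close>
    only the endpoint \<open>a\<close> can remain.\<close>
  have "B \<inter> cylinder k W \<subseteq> {a} \<union> {c..b}"
    using ab assms(4) unfolding c_def by fastforce
  then have "emeasure lebesgue (B \<inter> cylinder k W) \<le> emeasure lebesgue ({a} \<union> {c..b})"
    by (rule emeasure_mono) simp
  also have "\<dots> \<le> emeasure lebesgue {a} + emeasure lebesgue {c..b}"
    by (rule emeasure_subadditive) auto
  also have "\<dots> = ennreal (b - c)"
    using c by simp
  also have "b - c = (1 - 1 / real k ^ j) * (b - a)"
    by (simp add: c_def algebra_simps)
  also have "ennreal \<dots> = ennreal (1 - 1 / real k ^ j) * ennreal (b - a)"
    using kj ab(1) by (intro ennreal_mult) (auto simp: divide_le_eq)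
  also have "ennreal (b - a) = emeasure lebesgue {a<..<b}"
    using ab(1) by simp
  also have "\<dots> \<le> emeasure lebesgue (cylinder k W)"
    by (rule emeasure_mono[OF ab(2) cylinder_measurable[OF assms(1)]])
  finally show ?thesis
    by (simp add: mult_left_mono)
qed simp

lemma cylinder_expand:
  assumes "2 \<le> k" "x \<in> cylinder k W" "y \<in> cylinder k W" "x \<le> y" "length W = Suc n"
  shows "(real k - 1) ^ n * (y - x) \<le> orb y 1 (Suc n) - orb x 1 (Suc n)"
proof -
  have eq: "orb_poly ((!) W) i z = orb z 1 i" if "z \<in> cylinder k W" "i \<le> Suc n" for i z
    using that assms(1,5) by (intro orb_poly_eq_orb) (auto simp: cylinder_def)
  have "(real k - 1) ^ n * (y - x) \<le> orb_poly ((!) W) (Suc n) y - orb_poly ((!) W) (Suc n) x"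
    using assms(1-4) eq[OF assms(2)] orb_nonneg[of 1 x]
    by (intro orb_poly_expand) (auto simp: cylinder_def simp del: orb_poly.simps)
  then show ?thesis
    using eq assms(2,3) by (simp del: orb_poly.simps)
qed

text \<open>Orbit points after the start lie in \<open>[0, 1)\<close>, so expansion bounds the width
  of a cylinder. The bound tends to 0 as \<open>n\<close> grows once 3 \<le>
  \<open>k\<close>.\<close>

lemma cylinder_diameter:
  assumes "2 \<le> k" "x \<in> cylinder k W" "y \<in> cylinder k W" "length W = Suc n"
  shows "(real k - 1) ^ n * dist y x \<le> 1"
  using assms(2,3)
proof (induction x y rule: linorder_wlog)
  case (le x y)
  have "(real k - 1) ^ n * (y - x) \<le> orb y 1 (Suc n) - orb x 1 (Suc n)"
    using assms le by (intro cylinder_expand) auto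
  then show ?case
    using le orb_Suc_less_1[of y 1 n] orb_Suc_nonneg[of x 1 n] by (simp add: dist_real_def)
qed (simp add: dist_commute)

definition digit_prefix :: "real \<Rightarrow> nat \<Rightarrow> nat list" where
  "digit_prefix \<beta> n = map (beta_digit \<beta> 1) [0..<n]"

lemma length_digit_prefix [simp]: "length (digit_prefix \<beta> n) = n"
  by (simp add: digit_prefix_def)

lemma nth_digit_prefix [simp]: "i < n \<Longrightarrow> digit_prefix \<beta> n ! i = beta_digit \<beta> 1 i"
  by (simp add: digit_prefix_def)

lemma take_digit_prefix: "m \<le> n \<Longrightarrow> take m (digit_prefix \<beta> n) = digit_prefix \<beta> m"
  by (simp add: digit_prefix_def take_map)

lemma mem_cylinder_iff:
  "\<beta> \<in> cylinder k W \<longleftrightarrow> real k - 1 < \<beta> \<and> \<beta> < real k \<and> digit_prefix \<beta> (length W) = W"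
  by (auto simp: cylinder_def list_eq_iff_nth_eq)

text \<open>Among parameters sharing a prefix the orbit point is strictly increasing, so each finite
  word admits at most one zero, and there are countably many words.\<close>

lemma countable_orbit_of_1_meets_0:
  assumes "2 \<le> k"
  shows "countable {\<beta>. real k - 1 < \<beta> \<and> \<beta> < real k \<and> (\<exists>n. orb \<beta> 1 n = 0)}"
proof -
  define S where "S n = {\<beta>. real k - 1 < \<beta> \<and> \<beta> < real k \<and> orb \<beta> 1 (Suc n) = 0}" for n
  have "countable (S n)" for n
  proof (rule countable_image_inj_on)
    show "countable ((\<lambda>\<beta>. digit_prefix \<beta> (Suc n)) ` S n)"
      by (rule countableI_type)
    show "inj_on (\<lambda>\<beta>. digit_prefix \<beta> (Suc n)) (S n)"
    proof (rule linorder_inj_onI)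
      fix x y :: real
      assume xy: "x < y" "x \<in> S n" "y \<in> S n"
      show "digit_prefix x (Suc n) \<noteq> digit_prefix y (Suc n)"
      proof
        assume eq: "digit_prefix x (Suc n) = digit_prefix y (Suc n)"
        have "(real k - 1) ^ n * (y - x) \<le> orb y 1 (Suc n) - orb x 1 (Suc n)"
          using xy eq assms by (intro cylinder_expand[of k x "digit_prefix x (Suc n)"])
            (auto simp: mem_cylinder_iff S_def)
        moreover have "0 < (real k - 1) ^ n * (y - x)"
          using xy assms by simp
        ultimately show False
          using xy by (simp add: S_def)
      qed
    qed auto
  qed
  then have "countable (\<Union>n. S n)"
    by simp
  moreover have "{\<beta>. real k - 1 < \<beta> \<and> \<beta> < real k \<and> (\<exists>n. orb \<beta> 1 n = 0)} \<subseteq> (\<Union>n. S n)"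
  proof safe
    fix \<beta> n assume "real k - 1 < \<beta>" "\<beta> < real k" "orb \<beta> 1 n = 0"
    then show "\<beta> \<in> (\<Union>n. S n)"
      by (cases n) (auto simp: S_def)
  qed
  ultimately show ?thesis
    by (rule countable_subset[rotated])
qed

section \<open>Covering by cylinders of reset words\<close>

definition reset_words :: "nat list set" where
  "reset_words = {W. resets ((!) W) (length W)}"

lemma reset_word_nonempty: "W \<in> reset_words \<Longrightarrow> W \<noteq> []"
  using resets_pos by (auto simp: reset_words_def)

text \<open>Resets occur arbitrarily late and cylinders shrink with their length, so every parameter
  lies in arbitrarily small reset cylinders.\<close>

lemma small_reset_cylinder:
  assumes "3 \<le> k" "real k - 1 < \<beta>" "\<beta> < real k" "open U" "\<beta> \<in> U"
  shows "\<exists>n. digit_prefix \<beta> n \<in> reset_words \<and> cylinder k (digit_prefix \<beta> n) \<subseteq> U"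
proof -
  obtain e where e: "0 < e" "\<And>x. dist x \<beta> < e \<Longrightarrow> x \<in> U"
    using assms(4,5) open_dist by metis
  obtain N where N: "1 / e < (real k - 1) ^ N"
    using real_arch_pow[of "real k - 1" "1 / e"] assms(1) by auto
  obtain p where p: "Suc N \<le> p" "resets (beta_digit \<beta> 1) p"
    using resets_unbounded[of \<beta> "Suc N"] assms by auto
  then obtain n where n: "p = Suc n" "N \<le> n"
    by (cases p) auto
  let ?W = "digit_prefix \<beta> p"
  have "resets ((!) ?W) p"
    using p(2) by (rule resets_cong) simp
  then have "?W \<in> reset_words"
    by (simp add: reset_words_def)
  moreover have "cylinder k ?W \<subseteq> U"
  proof
    fix x assume x: "x \<in> cylinder k ?W"
    have "\<beta> \<in> cylinder k ?W"
      using assms by (simp add: mem_cylinder_iff)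
    then have "(real k - 1) ^ n * dist x \<beta> \<le> 1"
      using cylinder_diameter[of k \<beta> ?W x n] x assms(1) n(1) by simp
    moreover have "1 / e < (real k - 1) ^ n"
      using N power_increasing[OF n(2), of "real k - 1"] assms(1) by linarith
    then have "1 < (real k - 1) ^ n * e"
      using e(1) by (simp add: field_simps)
    ultimately have "(real k - 1) ^ n * dist x \<beta> < (real k - 1) ^ n * e"
      by simp
    then have "dist x \<beta> < e"
      using assms(1) by (simp add: mult_less_cancel_left_pos)
    then show "x \<in> U"
      by (rule e(2))
  qed
  ultimately show ?thesis by blast
qed

definition no_zeros_after_reset :: "nat \<Rightarrow> nat \<Rightarrow> real set" where
  "no_zeros_after_reset k j =
    {real k - 1<..<real k} - (\<Union>W\<in>reset_words. cylinder k (W @ replicate j 0))"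

lemma no_zeros_after_reset_measurable:
  "2 \<le> k \<Longrightarrow> no_zeros_after_reset k j \<in> sets lebesgue"
  unfolding no_zeros_after_reset_def
  by (intro sets.Diff sets.countable_UN'' cylinder_measurable) auto

text \<open>Cover the set \<open>B\<close> by an open \<open>U\<close> with little excess and decompose \<open>U\<close> into maximal reset
  cylinders: each loses a fixed proportion when intersected with \<open>B\<close>, so \<open>B\<close> must be null.\<close>

lemma no_zeros_after_reset_bound:
  assumes "3 \<le> k" "open U" "no_zeros_after_reset k j \<subseteq> U"
  shows "emeasure lebesgue (no_zeros_after_reset k j) \<le> ennreal (1 - 1 / real k ^ j) * emeasure lebesgue U"
proof -
  let ?B = "no_zeros_after_reset k j"
  have k2: "2 \<le> k"
    using assms(1) by simp
  define V where "V = {W \<in> reset_words. cylinder k W \<subseteq> U}"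
  \<comment> \<open>Words without a proper prefix in \<open>V\<close> index the maximal
    cylinders.\<close>
  define M where "M = {W \<in> V. \<forall>n<length W. take n W \<notin> V}"
  note B_meas = no_zeros_after_reset_measurable[OF k2, of j]
  have disj: "disjoint_family_on (cylinder k) M"
  proof (rule ccontr)
    assume "\<not> ?thesis"
    then obtain W W' x where W: "W \<in> M" "W' \<in> M" "W \<noteq> W'" "x \<in> cylinder k W" "x \<in> cylinder k W'"
      by (auto simp: disjoint_family_on_def)
    \<comment> \<open>Both words are prefixes of one expansion, so one is a proper prefix of the
      other, against minimality.\<close>
    then have eq: "W = digit_prefix x (length W)" "W' = digit_prefix x (length W')"
      by (simp_all add: mem_cylinder_iff)
    have "length W \<noteq> length W'"
      using eq W(3) by metis
    then consider "length W < length W'" | "length W' < length W"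
      by linarith
    then show False
    proof cases
      case 1
      then have "take (length W) W' = W"
        using eq take_digit_prefix[of "length W" "length W'" x] by simp
      with 1 W show False by (auto simp: M_def)
    next
      case 2
      then have "take (length W') W = W'"
        using eq take_digit_prefix[of "length W'" "length W" x] by simp
      with 2 W show False by (auto simp: M_def)
    qed
  qed
  have cover: "?B \<subseteq> (\<Union>W\<in>M. ?B \<inter> cylinder k W)"
  proof
    fix \<beta> assume \<beta>: "\<beta> \<in> ?B"
    then have range: "real k - 1 < \<beta>" "\<beta> < real k"
      by (auto simp: no_zeros_after_reset_def)
    have "\<exists>n. digit_prefix \<beta> n \<in> V"
      using small_reset_cylinder[OF assms(1) range assms(2)] \<beta> assms(3) by (auto simp: V_def)
    then obtain n where n: "digit_prefix \<beta> n \<in> V" "\<And>m. m < n \<Longrightarrow> digit_prefix \<beta> m \<notin> V"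
      using exists_least_iff[of "\<lambda>n. digit_prefix \<beta> n \<in> V"] by auto
    then have "digit_prefix \<beta> n \<in> M"
      by (auto simp: M_def take_digit_prefix)
    moreover have "\<beta> \<in> cylinder k (digit_prefix \<beta> n)"
      using range by (simp add: mem_cylinder_iff)
    ultimately show "\<beta> \<in> (\<Union>W\<in>M. ?B \<inter> cylinder k W)"
      using \<beta> by blast
  qed
  have shrink: "emeasure lebesgue (?B \<inter> cylinder k W)
      \<le> ennreal (1 - 1 / real k ^ j) * emeasure lebesgue (cylinder k W)" if "W \<in> M" for W
  proof (rule cylinder_proportion[OF k2 _ B_meas])
    have "W \<in> reset_words"
      using that by (simp add: M_def V_def)
    then show "W \<noteq> []" "?B \<inter> cylinder k (W @ replicate j 0) = {}"
      using reset_word_nonempty by (auto simp: no_zeros_after_reset_def)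
  qed
  have "emeasure lebesgue ?B \<le> emeasure lebesgue (\<Union>W\<in>M. ?B \<inter> cylinder k W)"
    using B_meas cylinder_measurable[OF k2]
    by (intro emeasure_mono[OF cover] sets.countable_UN'' sets.Int) auto
  also have "\<dots> = (\<integral>\<^sup>+W. emeasure lebesgue (?B \<inter> cylinder k W) \<partial>count_space M)"
  proof (rule emeasure_UN_countable)
    show "disjoint_family_on (\<lambda>W. ?B \<inter> cylinder k W) M"
      using disj by (auto simp: disjoint_family_on_def)
  qed (use B_meas cylinder_measurable[OF k2] in auto)
  also have "\<dots> \<le> (\<integral>\<^sup>+W. ennreal (1 - 1 / real k ^ j) * emeasure lebesgue (cylinder k W) \<partial>count_space M)"
    using shrink by (intro nn_integral_mono) simp
  also have "\<dots> = ennreal (1 - 1 / real k ^ j) * (\<integral>\<^sup>+W. emeasure lebesgue (cylinder k W) \<partial>count_space M)"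
    by (intro nn_integral_cmult) simp
  also have "(\<integral>\<^sup>+W. emeasure lebesgue (cylinder k W) \<partial>count_space M) = emeasure lebesgue (\<Union>W\<in>M. cylinder k W)"
    using disj cylinder_measurable[OF k2] by (intro emeasure_UN_countable[symmetric]) auto
  also have "\<dots> \<le> emeasure lebesgue U"
    using assms(2) by (intro emeasure_mono) (auto simp: M_def V_def)
  finally show ?thesis
    by (simp add: mult_left_mono)
qed

text \<open>Choosing \<open>U\<close> with excess below \<open>e\<close> shows that the measure
  \<open>m\<close> satisfies m \<le> q m + e for every positive \<open>e\<close>. As
  \<open>m\<close> is finite and \<open>q < 1\<close>, it must be 0.\<close>

lemma no_zeros_after_reset_null:
  assumes "3 \<le> k"
  shows "no_zeros_after_reset k j \<in> null_sets lebesgue"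
proof -
  let ?B = "no_zeros_after_reset k j"
  define q where "q = 1 - 1 / real k ^ j"
  have "1 \<le> real k ^ j"
    using assms by simp
  then have q: "0 \<le> q" "q < 1"
    using assms by (auto simp: q_def divide_le_eq)
  have B_meas: "?B \<in> sets lebesgue"
    using assms by (intro no_zeros_after_reset_measurable) simp
  have "emeasure lebesgue ?B \<le> emeasure lebesgue {real k - 1<..<real k}"
    by (intro emeasure_mono) (auto simp: no_zeros_after_reset_def)
  then have "emeasure lebesgue ?B < \<infinity>"
    by (simp add: order_le_less_trans)
  then have B_fin: "emeasure lebesgue ?B = ennreal (measure lebesgue ?B)"
    by (simp add: emeasure_eq_ennreal_measure)
  let ?m = "measure lebesgue ?B"
  have "?m \<le> q * ?m + e" if "0 < e" for e
  proof -
    obtain U where U: "open U" "?B \<subseteq> U" "emeasure lebesgue (U - ?B) < ennreal e"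
      using sets_lebesgue_outer_open[OF B_meas \<open>0 < e\<close>] by blast
    have "emeasure lebesgue U = emeasure lebesgue (?B \<union> (U - ?B))"
      using U(2) by (simp add: Un_absorb1)
    also have "\<dots> \<le> emeasure lebesgue ?B + emeasure lebesgue (U - ?B)"
      using B_meas U(1) by (intro emeasure_subadditive sets.Diff) auto
    also have "\<dots> \<le> ennreal ?m + ennreal e"
      unfolding B_fin[symmetric] using U(3) by (intro add_left_mono) simp
    also have "\<dots> = ennreal (?m + e)"
      using that by simp
    finally have "emeasure lebesgue U \<le> ennreal (?m + e)" .
    then have "ennreal ?m \<le> ennreal q * ennreal (?m + e)"
      using no_zeros_after_reset_bound[OF assms U(1,2)] B_fin
      by (metis q_def mult_left_mono order_trans zero_le)
    also have "ennreal q * ennreal (?m + e) = ennreal (q * (?m + e))"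
      using q(1) that by (intro ennreal_mult[symmetric]) auto
    finally have "?m \<le> q * (?m + e)"
      using q(1) that by (subst (asm) ennreal_le_iff) auto
    also have "\<dots> \<le> q * ?m + e"
      using q that by (simp add: distrib_left mult_left_le_one_le)
    finally show ?thesis .
  qed
  then have "?m \<le> q * ?m"
    by (rule field_le_epsilon)
  then have "?m = 0"
    using q(2) measure_nonneg[of lebesgue ?B] by (simp add: mult_le_cancel_right1 antisym)
  then show ?thesis
    using B_meas B_fin by (auto simp: null_sets_def)
qed

theorem theorem49:
  fixes k :: nat and lab :: "'k::finite \<Rightarrow> nat"
  assumes "k \<ge> 3"
    and "bij_betw lab UNIV {..<k}"
  shows "AE \<beta> in lebesgue. \<beta> \<in> {real k - 1<..<real k} \<longrightarrow>
           polytope (DF lab \<beta>) \<and>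
           (\<forall>v. v extreme_point_of (DF lab \<beta>) \<longrightarrow> rational_point v)"
proof -
  \<comment> \<open>Two null sets are discarded: the countable set where the orbit of 1 reaches 0,
    and the union over all \<open>j\<close> of the parameters without a reset followed by
    \<open>j\<close> zeros.\<close>
  let ?S = "{\<beta>. real k - 1 < \<beta> \<and> \<beta> < real k \<and> (\<exists>n. orb \<beta> 1 n = 0)}"
  have "?S \<in> null_sets lebesgue"
    using countable_orbit_of_1_meets_0[of k] assms(1)
    by (intro null_sets_completionI countable_imp_null_set_lborel) simp
  then have "AE \<beta> in lebesgue. \<beta> \<notin> ?S"
    by (rule AE_not_in)
  moreover have "AE \<beta> in lebesgue. \<forall>j. \<beta> \<notin> no_zeros_after_reset k j"
    unfolding AE_all_countable
    by (intro allI AE_not_in no_zeros_after_reset_null assms(1))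
  ultimately show ?thesis
  proof eventually_elim
    case (elim \<beta>)
    show ?case
    proof
      assume \<beta>: "\<beta> \<in> {real k - 1<..<real k}"
      have "\<exists>p. resets (beta_digit \<beta> 1) p \<and> (\<forall>i<j. beta_digit \<beta> 1 (p + i) = 0)" for j
      proof -
        have "\<beta> \<notin> no_zeros_after_reset k j"
          using elim by blast
        then obtain W where W: "W \<in> reset_words" "\<beta> \<in> cylinder k (W @ replicate j 0)"
          using \<beta> by (auto simp: no_zeros_after_reset_def)
        have "beta_digit \<beta> 1 i = (W @ replicate j 0) ! i" if "i < length W + j" for i
          using W(2) that by (simp add: cylinder_def)
        then have digits: "\<And>i. i < length W \<Longrightarrow> W ! i = beta_digit \<beta> 1 i"
          "\<And>i. i < j \<Longrightarrow> beta_digit \<beta> 1 (length W + i) = 0"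
          by (simp_all add: nth_append)
        have "resets ((!) W) (length W)"
          using W(1) by (simp add: reset_words_def)
        then have "resets (beta_digit \<beta> 1) (length W)"
          using digits(1) by (rule resets_cong)
        then show ?thesis
          using digits(2) by blast
      qed
      moreover have "1 < \<beta>" "\<beta> < real k" "orb \<beta> 1 r \<noteq> 0" for r
        using \<beta> elim assms(1) by auto
      ultimately obtain n where DF: "DF lab \<beta> = convex hull (block_freqs lab \<beta> n)"
        using DF_eq_hull[OF assms(2)] by blast
      show "polytope (DF lab \<beta>) \<and> (\<forall>v. v extreme_point_of (DF lab \<beta>) \<longrightarrow> rational_point v)"
      proof (intro conjI allI impI)
        show "polytope (DF lab \<beta>)"
          unfolding DF polytope_def using finite_block_freqs by blast
        fix v assume "v extreme_point_of (DF lab \<beta>)"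
        then have "v \<in> block_freqs lab \<beta> n"
          unfolding DF by (rule extreme_point_of_convex_hull)
        then show "rational_point v"
          by (rule rational_block_freqs)
      qed
    qed
  qed
qed

end
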